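(* For every $\varepsilon > 0$ there exist positive constants $\beta$, $\delta$, $\lambda$, $C$ such that the following holds for all $\ell$ and $n$ with $\ell \ge C\sqrt{n}$. Suppose that $\mathcal{P} = (M,E)$ is a pregraph on $n$ vertices with $e(E) \le \binom{\ell}{2}$ and that at least one of the following holds: (M1) $e(M) \ge 4\ell n$; (M2) $e(M) \ge (1-\delta)\ell n$, $E$ is not $\varepsilon$-close to $K_\ell$, and $\ell \le \lambda n$; (M3) there exists $U \subseteq V(K_n)$ with $|U| = \ell$, $e_E(U) \ge (1-\varepsilon)\binom{\ell}{2}$, and $e_M(U^c) \ge 7\sqrt{\varepsilon}\,\ell n$. Then there exist $i \in \{0,1,2\}$ and $\mathcal{H}_i \subseteq \mathcal{H}_i^{\mathcal{P}}$ such that \[ e(\mathcal{H}_i) \ge \beta\ell^4,\qquad \Delta_{(0,1)}(\mathcal{H}_i) \le \frac{\ell^3}{n}, \qquad \Delta_{(0,2)}(\mathcal{H}_i) \le \ell, \] and, if $i > 0$, then also $\Delta_{(1,0)}(\mathcal{H}_i) \le \ell^2$.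
   Context: A pregraph on $n$ vertices is a pair $\mathcal{P}=(M,E)$ of disjoint subsets of $E(K_n)$ (edges $E$, mixed edges $M$); $e(X)=|X|$, $e_X(U)$ is the number of elements of $X$ with both endpoints in $U$, and $U^c = V(K_n)\setminus U$. A good copy of $C_4$ in $\mathcal{P}$ is a $4$-cycle with all four edges in $M$ whose vertex set spans no element of $E$. A graph is $\varepsilon$-close to $K_\ell$ if it can be turned into a complete graph on some $\ell$ vertices (plus isolated vertices) by adding or deleting at most $\varepsilon\binom{\ell}{2}$ edges. For $i\in\{0,1,2\}$, $\mathcal{H}_i^{\mathcal{P}}$ is the hypergraph with vertex set $M$ consisting of all pairs $(A,B)$ such that $B$ is (the edge set of) a good copy of $C_4$ whose vertex set induces exactly $4+i$ elements of $M$, and $A$ is the set of the remaining $i$ elements of $M$ induced by this vertex set. For a hypergraph $\mathcal{H}$ of such pairs and disjoint sets $T_0,T_1$ of elements of $M$, $\deg_{\mathcal{H}}(T_0,T_1)$ is the number of $(A,B)\in\mathcal{H}$ with $T_0\subseteq A$ and $T_1\subseteq B$, and $\Delta_{(\ell_0,\ell_1)}(\mathcal{H})$ is its maximum over $|T_0|=\ell_0$, $|T_1|=\ell_1$; $e(\mathcal{H})$ is the number of pairs in $\mathcal{H}$. *)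

theory Defs
  imports Complex_Main "HOL-Library.Ramsey"
begin

text \<open>The vertex set of \<open>K\<^sub>n\<close> is \<open>{..<n}\<close>, and the edge set of the complete graph on a
  vertex set \<open>W\<close> is \<open>[W]\<^bsup>2\<^esup>\<close>, the set of two-element subsets of \<open>W\<close>.\<close>

definition pregraph :: "nat \<Rightarrow> nat set set \<Rightarrow> nat set set \<Rightarrow> bool" where
  "pregraph n M E \<longleftrightarrow> M \<subseteq> [{..<n}]\<^bsup>2\<^esup> \<and> E \<subseteq> [{..<n}]\<^bsup>2\<^esup> \<and> M \<inter> E = {}"

definition induced :: "'a set set \<Rightarrow> 'a set \<Rightarrow> 'a set set" where
  "induced X U = {e \<in> X. e \<subseteq> U}"

text \<open>The number of edges to be added or deleted to turn \<open>E\<close> into the complete graph on \<open>W\<close>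
  is the size of the symmetric difference of the two edge sets.\<close>

definition close_to_complete :: "nat \<Rightarrow> nat set set \<Rightarrow> real \<Rightarrow> nat \<Rightarrow> bool" where
  "close_to_complete n E \<epsilon> l \<longleftrightarrow>
     (\<exists>W \<subseteq> {..<n}. card W = l \<and>
        real (card ((E - [W]\<^bsup>2\<^esup>) \<union> ([W]\<^bsup>2\<^esup> - E))) \<le> \<epsilon> * real (l choose 2))"

definition is_C4 :: "'a set \<Rightarrow> 'a set set \<Rightarrow> bool" where
  "is_C4 S B \<longleftrightarrow>
     (\<exists>a b c d. distinct [a, b, c, d] \<and> S = {a, b, c, d} \<and>
        B = {{a, b}, {b, c}, {c, d}, {d, a}})"

definition good_C4 :: "'a set set \<Rightarrow> 'a set set \<Rightarrow> 'a set \<Rightarrow> 'a set set \<Rightarrow> bool" where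
  "good_C4 M E S B \<longleftrightarrow> is_C4 S B \<and> B \<subseteq> M \<and> induced E S = {}"

definition C4_hypergraph ::
    "'a set set \<Rightarrow> 'a set set \<Rightarrow> nat \<Rightarrow> ('a set set \<times> 'a set set) set" where
  "C4_hypergraph M E i =
     {(A, B). \<exists>S. good_C4 M E S B \<and> card (induced M S) = 4 + i \<and> A = induced M S - B}"

definition hdeg :: "('v set \<times> 'v set) set \<Rightarrow> 'v set \<Rightarrow> 'v set \<Rightarrow> nat" where
  "hdeg H T0 T1 = card {(A, B) \<in> H. T0 \<subseteq> A \<and> T1 \<subseteq> B}"

text \<open>The first argument is the vertex set of the hypergraph. The inserted \<open>0\<close> only matters
  when there are no sets of the required sizes, in which case the maximum is taken to be 0.\<close>

definition max_hdeg :: "'v set \<Rightarrow> nat \<Rightarrow> nat \<Rightarrow> ('v set \<times> 'v set) set \<Rightarrow> nat" where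
  "max_hdeg M l0 l1 H =
     Max (insert 0 {hdeg H T0 T1 | T0 T1.
       T0 \<subseteq> M \<and> T1 \<subseteq> M \<and> T0 \<inter> T1 = {} \<and> finite T0 \<and> finite T1 \<and>
       card T0 = l0 \<and> card T1 = l1})"

end

theory Submission imports Defs "HOL-Analysis.Convex" begin

text \<open>
  Take \<open>H\<^sub>i\<close> maximal subject to the degree conditions. If all of them are small, then only few edges,
  pairs of edges and diagonals are saturated. After deleting the saturated edges from \<open>M\<close> and adding
  the saturated diagonals to \<open>E\<close>, every remaining good 4-cycle contains a saturated pair of edges or
  belongs to some \<open>H\<^sub>i\<close>, so there are few of them.

  Let \<open>p(x)\<close> be the number of ordered pairs \<open>yy'\<close> of neighbours of \<open>x\<close> that are not in \<open>E\<close>. If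
  there were no good 4-cycle at all, then any two \<open>x, x'\<close> with a common pair \<open>yy'\<close> would form an
  element of \<open>E\<close>. Weighting \<open>x\<close> by \<open>p(x)\<^sup>-\<^sup>1\<^sup>/\<^sup>2\<close> and applying the Cauchy--Schwarz inequality to the
  total weights of the pairs \<open>yy'\<close> gives \<open>(\<Sum>\<^sub>x p(x)\<^sup>1\<^sup>/\<^sup>2)\<^sup>2 \<le> m (2 e(E) + n)\<close>, where \<open>m\<close> is the number
  of pairs \<open>yy'\<close> that may occur. The few exceptional 4-cycles only add lower-order terms. No
  regularity of the degrees is needed.

  Under (M1) and (M3) this inequality for all pairs already bounds the average degree. Under (M2) the
  vertices are split into a small set \<open>H\<close> of large degree and a set \<open>L\<close> of bounded degree. The
  inequality for pairs in \<open>H \<times> L\<close> shows that almost every vertex of \<open>L\<close> sends nearly all its edges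
  to \<open>H\<close> or nearly all to \<open>L\<close>; pairs in \<open>H \<times> H\<close> show that those of the first kind send fewer than
  \<open>(1 - \<zeta>) l\<close> edges to \<open>H\<close>, as \<open>E\<close> is not nearly complete on any set of about \<open>l\<close> vertices; and
  pairs in \<open>L \<times> L\<close> bound the edges between vertices of the second kind.
\<close>

section \<open>Weighted counting of 4-cycles\<close>

lemma weighted_cauchy_schwarz:
  fixes P :: "'a \<Rightarrow> 'b set"
  assumes fin: "finite X" "finite \<Omega>"
    and sub: "\<And>x. x \<in> X \<Longrightarrow> P x \<subseteq> \<Omega>"
  shows "(\<Sum>x\<in>X. sqrt (card (P x)))\<^sup>2 \<le> real (card \<Omega>) *
    (\<Sum>x\<in>X. \<Sum>x'\<in>X. card (P x \<inter> P x') / (sqrt (card (P x)) * sqrt (card (P x'))))"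
proof -
  \<comment> \<open>Division by zero yields 0, so a vertex with empty \<open>P x\<close> gets weight
    0 and drops out of both sums. The first moment of the total weight \<open>w\<close> over
    \<open>\<Omega>\<close> is the sum of the square roots, and its second moment is the sum of
    normalised overlaps.\<close>
  define q where "q x = 1 / sqrt (card (P x))" for x
  define w where "w z = (\<Sum>x\<in>X. q x * of_bool (z \<in> P x))" for z
  have "(\<Sum>z\<in>\<Omega>. w z) = (\<Sum>x\<in>X. \<Sum>z\<in>\<Omega>. q x * of_bool (z \<in> P x))"
    unfolding w_def by (rule sum.swap)
  also have "\<dots> = (\<Sum>x\<in>X. sqrt (card (P x)))"
  proof (rule sum.cong[OF refl])
    fix x assume x: "x \<in> X"
    have "(\<Sum>z\<in>\<Omega>. q x * of_bool (z \<in> P x)) = q x * card (\<Omega> \<inter> P x)"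
      using fin by (simp add: sum_distrib_left[symmetric] of_bool_def sum.If_cases)
    also have "\<Omega> \<inter> P x = P x" using sub[OF x] by blast
    also have "q x * card (P x) = sqrt (card (P x))"
      by (simp add: q_def real_div_sqrt)
    finally show "(\<Sum>z\<in>\<Omega>. q x * of_bool (z \<in> P x)) = sqrt (card (P x))" .
  qed
  finally have 1: "(\<Sum>z\<in>\<Omega>. w z) = (\<Sum>x\<in>X. sqrt (card (P x)))" .
  have "(\<Sum>z\<in>\<Omega>. (w z)\<^sup>2) =
      (\<Sum>z\<in>\<Omega>. \<Sum>x\<in>X. \<Sum>x'\<in>X. q x * q x' * of_bool (z \<in> P x \<inter> P x'))"
    unfolding w_def power2_eq_square sum_product
    by (intro sum.cong refl) auto
  also have "\<dots> = (\<Sum>x\<in>X. \<Sum>z\<in>\<Omega>. \<Sum>x'\<in>X. q x * q x' * of_bool (z \<in> P x \<inter> P x'))"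
    by (rule sum.swap)
  also have "\<dots> = (\<Sum>x\<in>X. \<Sum>x'\<in>X. \<Sum>z\<in>\<Omega>. q x * q x' * of_bool (z \<in> P x \<inter> P x'))"
    by (intro sum.cong refl sum.swap)
  also have "\<dots> = (\<Sum>x\<in>X. \<Sum>x'\<in>X. card (P x \<inter> P x') / (sqrt (card (P x)) * sqrt (card (P x'))))"
  proof (intro sum.cong refl)
    fix x x' assume x: "x \<in> X" "x' \<in> X"
    have "(\<Sum>z\<in>\<Omega>. q x * q x' * of_bool (z \<in> P x \<inter> P x')) =
        q x * q x' * (\<Sum>z\<in>\<Omega>. of_bool (z \<in> P x \<inter> P x'))"
      by (rule sum_distrib_left[symmetric])
    also have "(\<Sum>z\<in>\<Omega>. of_bool (z \<in> P x \<inter> P x') :: real) = card (\<Omega> \<inter> (P x \<inter> P x'))"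
      using fin by (simp add: of_bool_def sum.If_cases Collect_conj_eq)
    also have "\<Omega> \<inter> (P x \<inter> P x') = P x \<inter> P x'" using sub[OF x(1)] by blast
    finally show "(\<Sum>z\<in>\<Omega>. q x * q x' * of_bool (z \<in> P x \<inter> P x')) =
      card (P x \<inter> P x') / (sqrt (card (P x)) * sqrt (card (P x')))"
      by (simp add: q_def field_simps)
  qed
  finally have 2: "(\<Sum>z\<in>\<Omega>. (w z)\<^sup>2) =
    (\<Sum>x\<in>X. \<Sum>x'\<in>X. card (P x \<inter> P x') / (sqrt (card (P x)) * sqrt (card (P x'))))" .
  have "(\<Sum>z\<in>\<Omega>. w z)\<^sup>2 \<le> (\<Sum>z\<in>\<Omega>. (w z)\<^sup>2) * card \<Omega>"
    by (rule sum_squared_le_sum_of_squares)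
  thus ?thesis unfolding 1 2 by (simp add: mult.commute)
qed

text \<open>Used to sum codegrees: when some coordinates \<open>z\<close> of the tuples in
  \<open>Q\<close> are fixed, the remaining coordinates range over \<open>W z\<close>, and
  injectivity of \<open>f\<close> makes these slices disjoint inside \<open>Q\<close>.\<close>

lemma sum_card_fibres_le:
  assumes "finite Z" "finite Q" "\<And>z w. z \<in> Z \<Longrightarrow> w \<in> W z \<Longrightarrow> f z w \<in> Q"
    and "\<And>z w z' w'. f z w = f z' w' \<Longrightarrow> z = z' \<and> w = w'"
  shows "(\<Sum>z\<in>Z. card (W z)) \<le> card Q"
proof -
  have inj: "inj_on (\<lambda>(z, w). f z w) (SIGMA z:Z. W z)"
    using assms(4) by (auto simp: inj_on_def)
  have sub: "(\<lambda>(z, w). f z w) ` (SIGMA z:Z. W z) \<subseteq> Q" using assms(3) by auto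
  have "finite (W z)" if "z \<in> Z" for z
  proof (rule finite_subset[of _ "f z -` Q"])
    show "W z \<subseteq> f z -` Q" using assms(3) that by auto
    show "finite (f z -` Q)" using assms(2,4) by (intro finite_vimageI) (auto simp: inj_def)
  qed
  hence "(\<Sum>z\<in>Z. card (W z)) = card (SIGMA z:Z. W z)"
    using assms(1) by (simp add: card_SigmaI)
  also have "\<dots> \<le> card Q" using card_inj_on_le[OF inj sub assms(2)] .
  finally show ?thesis .
qed

text \<open>The relation \<open>forb\<close> consists of the forbidden diagonals, \<open>Q\<close> of the forbidden paths of length
  two with the centre in the middle, and \<open>J\<close> of the exceptional 4-cycles in cyclic order.\<close>

locale almost_C4_free =
  fixes V :: "'a set" and adj forb :: "'a \<Rightarrow> 'a \<Rightarrow> bool"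
    and Q :: "('a \<times> 'a \<times> 'a) set" and J :: "('a \<times> 'a \<times> 'a \<times> 'a) set"
    and t \<gamma> :: real
  assumes finV: "finite V" and finQ: "finite Q" and finJ: "finite J"
    and adj_sym: "adj x y \<Longrightarrow> adj y x"
    and forb_sym: "forb x y \<Longrightarrow> forb y x"
    and no_C4: "\<lbrakk>x \<in> V; y \<in> V; x' \<in> V; y' \<in> V; x \<noteq> x'; y \<noteq> y';
      adj x y; adj y x'; adj x' y'; adj y' x; \<not> forb x x'; \<not> forb y y';
      (y, x, y') \<notin> Q; (y, x', y') \<notin> Q; (x, y, x') \<notin> Q; (x, y', x') \<notin> Q\<rbrakk>
      \<Longrightarrow> (x, y, x', y') \<in> J"
    and t_pos: "t > 0"
    and card_V: "real (card V) \<le> \<gamma> * t\<^sup>2"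
    and card_Q: "real (card Q) \<le> \<gamma> * t ^ 3"
    and card_J: "real (card J) \<le> \<gamma> * t ^ 4"
    and card_forb: "real (card {(x, y) \<in> V \<times> V. forb x y}) \<le> 3/2 * t\<^sup>2"
begin

definition nb :: "'a \<Rightarrow> 'a set \<Rightarrow> 'a set" where
  "nb x S = {y \<in> S. adj x y}"

text \<open>Paths of \<open>Q\<close> centred at \<open>x\<close> are excluded here, so that
  comparing two vertices leaves only paths centred at \<open>y\<close> or \<open>y'\<close>.
  \<open>N\<close> and \<open>\<Omega>\<close> are parameters because truncated neighbourhoods and
  pairs in a product of two different classes are needed later.\<close>

definition good_pairs :: "'a set \<Rightarrow> ('a \<times> 'a) set \<Rightarrow> 'a \<Rightarrow> ('a \<times> 'a) set" where
  "good_pairs N \<Omega> x = {(y, y') \<in> \<Omega>. y \<in> N \<and> y' \<in> N \<and> y \<noteq> y' \<and> \<not> forb y y' \<and> (y, x, y') \<notin> Q}"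

lemma gamma_nonneg: "\<gamma> \<ge> 0"
proof -
  have "0 \<le> \<gamma> * t\<^sup>2" using card_V by (meson of_nat_0_le_iff order_trans)
  thus ?thesis using t_pos by (simp add: zero_le_mult_iff)
qed

text \<open>A good pair common to \<open>x\<close> and \<open>x'\<close> closes a 4-cycle. Hence the
  normalised overlap is at most 1 on equal or forbidden pairs and is otherwise charged to
  \<open>Q\<close> and \<open>J\<close>. The hypotheses \<open>p1\<close> and \<open>p2\<close> keep
  the normalising factors large enough for these charges to be of lower order.\<close>

lemma sum_sqrt_good_pairs_le:
  assumes X: "X \<subseteq> V" and N: "\<And>x. x \<in> X \<Longrightarrow> N x \<subseteq> nb x V" and Pi: "\<Omega> \<subseteq> V \<times> V"
    and k: "0 < \<kappa>" "\<kappa> \<le> 1" "8 * \<gamma> \<le> \<kappa>"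
    and p1: "\<And>x. x \<in> X \<Longrightarrow> \<kappa> * (real (card (N x)))\<^sup>2 \<le> card (good_pairs (N x) \<Omega> x)"
    and p2: "\<And>x. x \<in> X \<Longrightarrow> \<kappa> * t\<^sup>2 \<le> card (good_pairs (N x) \<Omega> x)"
  shows "(\<Sum>x\<in>X. sqrt (card (good_pairs (N x) \<Omega> x)))\<^sup>2 \<le> 2 * t\<^sup>2 * real (card \<Omega>)"
proof -
  define P where "P x = good_pairs (N x) \<Omega> x" for x
  define s where "s x = sqrt (card (P x))" for x
  have finX: "finite X" and finPi: "finite \<Omega>"
    using X Pi finV by (auto intro: finite_subset)
  have finN: "finite (N x)" if "x \<in> X" for x
    using N[OF that] finV by (auto simp: nb_def intro: finite_subset)
  have PPi: "P x \<subseteq> \<Omega>" for x by (auto simp: P_def good_pairs_def)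
  have finP: "finite (P x)" for x using PPi finPi by (rule finite_subset)
  have ss: "s x * s x = card (P x)" for x by (simp add: s_def)
  have s1: "sqrt \<kappa> * card (N x) \<le> s x" if "x \<in> X" for x
    using real_sqrt_le_mono[OF p1[OF that]] by (simp add: s_def P_def real_sqrt_mult)
  have s2: "sqrt \<kappa> * t \<le> s x" if "x \<in> X" for x
    using real_sqrt_le_mono[OF p2[OF that]] t_pos by (simp add: s_def P_def real_sqrt_mult)
  have sk: "sqrt \<kappa> > 0" "sqrt \<kappa> * sqrt \<kappa> = \<kappa>" using k by auto
  have sk3: "(sqrt \<kappa> * a) * (sqrt \<kappa> * b) = \<kappa> * (a * b)" for a b
  proof -
    have "(sqrt \<kappa> * a) * (sqrt \<kappa> * b) = (sqrt \<kappa> * sqrt \<kappa>) * (a * b)" by (simp only: ac_simps)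
    thus ?thesis by (simp only: sk(2))
  qed
  have spos: "s x > 0" if "x \<in> X" for x
    using s2[OF that] sk t_pos by (meson mult_pos_pos less_le_trans)
  define Qy where "Qy z = {y. (fst z, y, snd z) \<in> Q}" for z
  define Jy where "Jy z = {u. (fst z, fst u, snd z, snd u) \<in> J}" for z
  have finQy: "finite (Qy z)" for z
    unfolding Qy_def by (rule finite_subset[OF _ finite_imageI[OF finQ, of "\<lambda>(a,b,c). b"]]) force
  have finJy: "finite (Jy z)" for z
    unfolding Jy_def by (rule finite_subset[OF _ finite_imageI[OF finJ, of "\<lambda>(a,b,c,d). (b,d)"]]) force
  have pointwise: "card (P x \<inter> P x') / (s x * s x') \<le>
      of_bool (x = x') + of_bool (forb x x') + 2 / (\<kappa> * t) * card (Qy (x, x'))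
      + 1 / (\<kappa> * t\<^sup>2) * card (Jy (x, x'))" if x: "x \<in> X" "x' \<in> X" for x x'
  proof (cases "x = x' \<or> forb x x'")
    case True
    have a: "card (P x \<inter> P x') \<le> card (P x)" "card (P x \<inter> P x') \<le> card (P x')"
      by (auto intro!: card_mono finP)
    have "(card (P x \<inter> P x'))\<^sup>2 \<le> card (P x) * card (P x')"
      using mult_mono[OF a] by (simp add: power2_eq_square)
    hence "(real (card (P x \<inter> P x')))\<^sup>2 \<le> real (card (P x)) * real (card (P x'))"
      by (metis of_nat_le_iff of_nat_mult of_nat_power)
    also have "\<dots> = (s x * s x')\<^sup>2" by (simp add: power2_eq_square flip: ss)
    finally have "card (P x \<inter> P x') \<le> s x * s x'"
      by (rule power2_le_imp_le) (use spos x in \<open>auto intro: less_imp_le mult_pos_pos\<close>)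
    hence "card (P x \<inter> P x') / (s x * s x') \<le> 1"
      using spos x by (simp add: divide_le_eq)
    also have "1 \<le> of_bool (x = x') + (of_bool (forb x x') :: real)" using True by auto
    also have "\<dots> \<le> of_bool (x = x') + of_bool (forb x x') + (2 / (\<kappa> * t) * card (Qy (x, x'))
      + 1 / (\<kappa> * t\<^sup>2) * card (Jy (x, x')))" using k t_pos by simp
    finally show ?thesis by (simp only: add.assoc)
  next
    case False
    \<comment> \<open>For a common pair \<open>(y, y')\<close> either one of \<open>y\<close>,
      \<open>y'\<close> is the centre of a path of \<open>Q\<close> from \<open>x\<close> to
      \<open>x'\<close>, the other one being free in \<open>N x\<close>, or the whole cycle lies in
      \<open>J\<close>.\<close>
    let ?A = "Qy (x, x') \<times> N x" and ?B = "N x \<times> Qy (x, x')"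
    have "P x \<inter> P x' \<subseteq> ?A \<union> ?B \<union> Jy (x, x')"
    proof
      fix u assume u: "u \<in> P x \<inter> P x'"
      obtain y y' where [simp]: "u = (y, y')" by (cases u)
      have "y \<in> N x" "y' \<in> N x" "y \<in> N x'" "y' \<in> N x'" "y \<noteq> y'" "\<not> forb y y'"
        "(y, x, y') \<notin> Q" "(y, x', y') \<notin> Q"
        using u by (auto simp: P_def good_pairs_def)
      moreover from this have "y \<in> V" "y' \<in> V" "adj x y" "adj x y'" "adj x' y" "adj x' y'"
        using N[OF x(1)] N[OF x(2)] by (auto simp: nb_def)
      ultimately show "u \<in> ?A \<union> ?B \<union> Jy (x, x')"
        using no_C4[of x y x' y'] False x X adj_sym by (auto simp: Qy_def Jy_def)
    qed
    hence "card (P x \<inter> P x') \<le> card (?A \<union> ?B \<union> Jy (x, x'))"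
      by (intro card_mono) (use finQy finJy finN x in auto)
    also have "\<dots> \<le> card ?A + card ?B + card (Jy (x, x'))"
      by (meson add_le_mono1 card_Un_le le_trans)
    also have "\<dots> = 2 * card (Qy (x, x')) * card (N x) + card (Jy (x, x'))"
      by (simp add: card_cartesian_product)
    finally have c: "real (card (P x \<inter> P x')) \<le>
        2 * real (card (Qy (x, x'))) * real (card (N x)) + real (card (Jy (x, x')))"
      using of_nat_mono[where ?'a = real] by fastforce
    \<comment> \<open>The factor \<open>s x\<close> pays for the free vertex in \<open>N x\<close>
      by \<open>p1\<close>, and \<open>s x'\<close> contributes a factor \<open>t\<close> by
      \<open>p2\<close>; so each path of \<open>Q\<close> costs only order
      \<open>1 / t\<close>.\<close>
    have "\<kappa> * t * card (N x) = (sqrt \<kappa> * card (N x)) * (sqrt \<kappa> * t)"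
      by (simp add: sk3)
    also have "\<dots> \<le> s x * s x'"
      using s1[OF x(1)] s2[OF x(2)] spos[OF x(1)] sk t_pos by (intro mult_mono) auto
    finally have d1: "card (N x) / (s x * s x') \<le> 1 / (\<kappa> * t)"
      using spos x k t_pos by (simp add: field_simps)
    have "\<kappa> * t\<^sup>2 = (sqrt \<kappa> * t) * (sqrt \<kappa> * t)"
      by (simp add: sk3 power2_eq_square)
    also have "\<dots> \<le> s x * s x'"
      using s2[OF x(1)] s2[OF x(2)] spos[OF x(1)] sk t_pos by (intro mult_mono) auto
    finally have d2: "1 / (s x * s x') \<le> 1 / (\<kappa> * t\<^sup>2)"
      using spos x k t_pos by (simp add: field_simps)
    have "card (P x \<inter> P x') / (s x * s x') \<le>
      (2 * real (card (Qy (x, x'))) * real (card (N x)) + real (card (Jy (x, x')))) / (s x * s x')"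
      using c spos x by (intro divide_right_mono) (auto intro: less_imp_le mult_pos_pos)
    also have "\<dots> = 2 * card (Qy (x, x')) * (card (N x) / (s x * s x'))
        + card (Jy (x, x')) * (1 / (s x * s x'))" by (simp add: add_divide_distrib)
    also have "\<dots> \<le> 2 * card (Qy (x, x')) * (1 / (\<kappa> * t)) + card (Jy (x, x')) * (1 / (\<kappa> * t\<^sup>2))"
      by (intro add_mono mult_left_mono d1 d2) auto
    finally show ?thesis using False by (simp add: algebra_simps)
  qed
  have finXX: "finite (X \<times> X)" using finX by simp
  have b1: "(\<Sum>z\<in>X\<times>X. of_bool (fst z = snd z) :: real) \<le> \<gamma> * t\<^sup>2"
  proof -
    have "(\<Sum>z\<in>X\<times>X. of_bool (fst z = snd z) :: real) = (\<Sum>x\<in>X. \<Sum>x'\<in>X. of_bool (x = x'))"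
      by (simp add: sum.cartesian_product case_prod_beta)
    also have "\<dots> = card X" using finX by (simp add: of_bool_def)
    also have "\<dots> \<le> card V" using X finV by (simp add: card_mono)
    finally show ?thesis using card_V by simp
  qed
  have b2: "(\<Sum>z\<in>X\<times>X. of_bool (forb (fst z) (snd z)) :: real) \<le> 3/2 * t\<^sup>2"
  proof -
    have "(\<Sum>z\<in>X\<times>X. of_bool (forb (fst z) (snd z)) :: real)
       = card ((X\<times>X) \<inter> {z. forb (fst z) (snd z)})"
      using finXX by (simp add: of_bool_def sum.If_cases)
    also have "\<dots> \<le> card {(x, y) \<in> V \<times> V. forb x y}"
      unfolding of_nat_le_iff
    proof (rule card_mono)
      show "finite {(x, y) \<in> V \<times> V. forb x y}"
        by (rule finite_subset[of _ "V \<times> V"]) (use finV in auto)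
    qed (use X in auto)
    finally show ?thesis using card_forb by simp
  qed
  have b3: "(\<Sum>z\<in>X\<times>X. real (card (Qy z))) \<le> \<gamma> * t ^ 3"
  proof -
    have "(\<Sum>z\<in>X\<times>X. card (Qy z)) \<le> card Q"
      by (rule sum_card_fibres_le[where f = "\<lambda>z y. (fst z, y, snd z)"])
        (use finXX finQ in \<open>auto simp: Qy_def prod_eq_iff\<close>)
    hence "real (\<Sum>z\<in>X\<times>X. card (Qy z)) \<le> real (card Q)" by (simp only: of_nat_le_iff)
    thus ?thesis using card_Q by simp
  qed
  have b4: "(\<Sum>z\<in>X\<times>X. real (card (Jy z))) \<le> \<gamma> * t ^ 4"
  proof -
    have "(\<Sum>z\<in>X\<times>X. card (Jy z)) \<le> card J"
      by (rule sum_card_fibres_le[where f = "\<lambda>z u. (fst z, fst u, snd z, snd u)"])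
        (use finXX finJ in \<open>auto simp: Jy_def prod_eq_iff\<close>)
    hence "real (\<Sum>z\<in>X\<times>X. card (Jy z)) \<le> real (card J)" by (simp only: of_nat_le_iff)
    thus ?thesis using card_J by simp
  qed
  have "(\<Sum>x\<in>X. \<Sum>x'\<in>X. card (P x \<inter> P x') / (s x * s x')) =
      (\<Sum>z\<in>X\<times>X. card (P (fst z) \<inter> P (snd z)) / (s (fst z) * s (snd z)))"
    by (simp add: sum.cartesian_product case_prod_beta)
  also have "\<dots> \<le> (\<Sum>z\<in>X\<times>X. of_bool (fst z = snd z) + of_bool (forb (fst z) (snd z))
       + 2 / (\<kappa> * t) * card (Qy z) + 1 / (\<kappa> * t\<^sup>2) * card (Jy z))"
  proof (rule sum_mono)
    fix z assume "z \<in> X \<times> X"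
    thus "card (P (fst z) \<inter> P (snd z)) / (s (fst z) * s (snd z)) \<le>
       of_bool (fst z = snd z) + of_bool (forb (fst z) (snd z))
       + 2 / (\<kappa> * t) * card (Qy z) + 1 / (\<kappa> * t\<^sup>2) * card (Jy z)"
      using pointwise[of "fst z" "snd z"] by auto
  qed
  also have "\<dots> = (\<Sum>z\<in>X\<times>X. of_bool (fst z = snd z)) + (\<Sum>z\<in>X\<times>X. of_bool (forb (fst z) (snd z)))
       + 2 / (\<kappa> * t) * (\<Sum>z\<in>X\<times>X. real (card (Qy z))) + 1 / (\<kappa> * t\<^sup>2) * (\<Sum>z\<in>X\<times>X. real (card (Jy z)))"
    by (simp only: sum.distrib sum_distrib_left)
  also have "\<dots> \<le> \<gamma> * t\<^sup>2 + 3/2 * t\<^sup>2 + 2 / (\<kappa> * t) * (\<gamma> * t ^ 3) + 1 / (\<kappa> * t\<^sup>2) * (\<gamma> * t ^ 4)"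
    using k t_pos by (intro add_mono b1 b2 mult_left_mono b3 b4) auto
  also have "\<dots> = (\<gamma> + 3/2 + 3 * (\<gamma> / \<kappa>)) * t\<^sup>2"
    using k t_pos by (simp add: field_simps power2_eq_square power3_eq_cube power4_eq_xxxx)
  \<comment> \<open>The diagonal gives \<open>\<gamma>\<close>, the forbidden pairs 3/2, and
    \<open>Q\<close> and \<open>J\<close> together \<open>3 * \<gamma> / \<kappa>\<close>. With
    \<open>8 * \<gamma> \<le> \<kappa>\<close> the sum is at most 1/8 + 3/2 + 3/8 = 2.\<close>
  also have "\<dots> \<le> 2 * t\<^sup>2"
  proof (rule mult_right_mono)
    have "\<gamma> / \<kappa> \<le> 1/8" using k by (simp add: field_simps)
    moreover have "\<gamma> \<le> 1/8" using k by simp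
    ultimately show "\<gamma> + 3/2 + 3 * (\<gamma> / \<kappa>) \<le> 2" by linarith
  qed simp
  finally have T: "(\<Sum>x\<in>X. \<Sum>x'\<in>X. card (P x \<inter> P x') / (s x * s x')) \<le> 2 * t\<^sup>2" .
  have "(\<Sum>x\<in>X. s x)\<^sup>2 \<le> card \<Omega> * (\<Sum>x\<in>X. \<Sum>x'\<in>X. card (P x \<inter> P x') / (s x * s x'))"
    unfolding s_def using weighted_cauchy_schwarz[OF finX finPi, of P] PPi by simp
  also have "\<dots> \<le> card \<Omega> * (2 * t\<^sup>2)" by (intro mult_left_mono T) auto
  finally show ?thesis by (simp add: s_def P_def mult.commute)
qed

text \<open>The form in which the counting inequality is applied: \<open>w\<close> is a degree, or a
  minimum of two degrees, whose square is controlled by the number of good pairs. Its total is then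
  of order \<open>t\<close> times the square root of \<open>card \<Omega>\<close>, so a small
  \<open>\<Omega>\<close> gives a strong bound.\<close>

lemma sum_le_of_good_pairs:
  fixes w :: "'a \<Rightarrow> real" and b c :: real
  assumes X: "X \<subseteq> V" and N: "\<And>x. x \<in> X \<Longrightarrow> N x \<subseteq> nb x V" and Pi: "\<Omega> \<subseteq> V \<times> V"
    and k: "0 < \<kappa>" "\<kappa> \<le> 1" "8 * \<gamma> \<le> \<kappa>"
    and p1: "\<And>x. x \<in> X \<Longrightarrow> \<kappa> * (real (card (N x)))\<^sup>2 \<le> card (good_pairs (N x) \<Omega> x)"
    and p2: "\<And>x. x \<in> X \<Longrightarrow> \<kappa> * t\<^sup>2 \<le> card (good_pairs (N x) \<Omega> x)"
    and c: "c > 0" and w: "\<And>x. x \<in> X \<Longrightarrow> w x \<ge> 0"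
    and p3: "\<And>x. x \<in> X \<Longrightarrow> c * (w x)\<^sup>2 \<le> card (good_pairs (N x) \<Omega> x)"
    and b: "b \<ge> 0" "2 * t\<^sup>2 * real (card \<Omega>) \<le> c * b\<^sup>2"
  shows "(\<Sum>x\<in>X. w x) \<le> b"
proof -
  have "sqrt c * (\<Sum>x\<in>X. w x) \<le> (\<Sum>x\<in>X. sqrt (card (good_pairs (N x) \<Omega> x)))"
    unfolding sum_distrib_left
  proof (rule sum_mono)
    fix x assume x: "x \<in> X"
    show "sqrt c * w x \<le> sqrt (card (good_pairs (N x) \<Omega> x))"
      using real_sqrt_le_mono[OF p3[OF x]] w[OF x] by (simp add: real_sqrt_mult)
  qed
  hence "(sqrt c * (\<Sum>x\<in>X. w x))\<^sup>2 \<le> (\<Sum>x\<in>X. sqrt (card (good_pairs (N x) \<Omega> x)))\<^sup>2"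
    using c w by (intro power_mono) (auto intro!: mult_nonneg_nonneg sum_nonneg)
  also have "\<dots> \<le> 2 * t\<^sup>2 * real (card \<Omega>)"
    by (rule sum_sqrt_good_pairs_le[OF X N Pi k p1 p2])
  also note b(2)
  finally have "c * (\<Sum>x\<in>X. w x)\<^sup>2 \<le> c * b\<^sup>2" using c by (simp add: power_mult_distrib)
  hence "(\<Sum>x\<in>X. w x)\<^sup>2 \<le> b\<^sup>2" using c by simp
  thus ?thesis using b(1) by (rule power2_le_imp_le)
qed

section \<open>Bounds on the degrees\<close>

definition qdeg :: "'a \<Rightarrow> nat" where
  "qdeg x = card {u. (fst u, x, snd u) \<in> Q}"

definition fdeg :: "'a \<Rightarrow> nat" where
  "fdeg x = card {y \<in> V. forb x y}"

lemma finite_nb: "S \<subseteq> V \<Longrightarrow> finite (nb x S)"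
  using finV by (auto simp: nb_def intro: finite_subset)

lemma nb_subset: "nb x S \<subseteq> S"
  by (auto simp: nb_def)

lemma sum_qdeg_le:
  assumes "X \<subseteq> V" shows "(\<Sum>x\<in>X. real (qdeg x)) \<le> \<gamma> * t ^ 3"
proof -
  have "(\<Sum>x\<in>X. qdeg x) \<le> card Q"
    unfolding qdeg_def
    by (rule sum_card_fibres_le[where f = "\<lambda>x u. (fst u, x, snd u)"])
      (use finQ finite_subset[OF assms finV] in \<open>auto simp: prod_eq_iff\<close>)
  hence "real (\<Sum>x\<in>X. qdeg x) \<le> real (card Q)" by (simp only: of_nat_le_iff)
  thus ?thesis using card_Q by simp
qed

lemma sum_fdeg_le:
  assumes "X \<subseteq> V" shows "(\<Sum>x\<in>X. real (fdeg x)) \<le> 3/2 * t\<^sup>2"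
proof -
  have "(\<Sum>x\<in>X. fdeg x) \<le> card {(x, y) \<in> V \<times> V. forb x y}"
    unfolding fdeg_def
    by (rule sum_card_fibres_le[where f = Pair])
      (use finV finite_subset[OF assms finV] assms in
        \<open>auto simp: prod_eq_iff intro: finite_subset[of _ "V \<times> V"]\<close>)
  hence "real (\<Sum>x\<in>X. fdeg x) \<le> real (card {(x, y) \<in> V \<times> V. forb x y})"
    by (simp only: of_nat_le_iff)
  thus ?thesis using card_forb by simp
qed

text \<open>A pair in \<open>A \<times> B\<close> fails to be good only if it is on the diagonal, is
  forbidden, or forms a path of \<open>Q\<close> through \<open>x\<close>; the three subtracted
  terms count these failures.\<close>

lemma card_good_pairs_ge:
  assumes "A \<times> B \<subseteq> \<Omega>" "A \<subseteq> N" "B \<subseteq> N" "N \<subseteq> V" "\<Omega> \<subseteq> V \<times> V"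
  shows "real (card A) * real (card B) - real (card (A \<inter> B))
     - real (card {(y, y') \<in> A \<times> B. forb y y'}) - real (qdeg x) \<le> real (card (good_pairs N \<Omega> x))"
proof -
  have finAB: "finite A" "finite B" using assms(2-4) finV by (meson finite_subset)+
  have finO: "finite \<Omega>" using assms(5) finV by (meson finite_SigmaI finite_subset)
  have finq: "finite {u. (fst u, x, snd u) \<in> Q}"
    by (rule finite_subset[OF _ finite_imageI[OF finQ, of "\<lambda>(a,b,c). (a, c)"]]) force
  have fing: "finite (good_pairs N \<Omega> x)"
    by (rule finite_subset[OF _ finO]) (auto simp: good_pairs_def)
  have finf: "finite {(y, y') \<in> A \<times> B. forb y y'}"
    by (rule finite_subset[of _ "A \<times> B"]) (use finAB in auto)
  let ?D = "(\<lambda>y. (y, y)) ` (A \<inter> B)"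
  have "A \<times> B \<subseteq> good_pairs N \<Omega> x \<union> ?D \<union> {(y, y') \<in> A \<times> B. forb y y'} \<union> {u. (fst u, x, snd u) \<in> Q}"
    using assms(1-3) by (auto simp: good_pairs_def)
  hence "card (A \<times> B) \<le> card (good_pairs N \<Omega> x \<union> ?D \<union> {(y, y') \<in> A \<times> B. forb y y'} \<union> {u. (fst u, x, snd u) \<in> Q})"
    by (intro card_mono) (use finAB finf finq fing in auto)
  also have "\<dots> \<le> card (good_pairs N \<Omega> x) + card ?D + card {(y, y') \<in> A \<times> B. forb y y'} + qdeg x"
    unfolding qdeg_def by (intro order_trans[OF card_Un_le] add_mono le_refl)
  also have "card ?D = card (A \<inter> B)" by (intro card_image) (auto simp: inj_on_def)
  finally have "card A * card B \<le>
     card (good_pairs N \<Omega> x) + card (A \<inter> B) + card {(y, y') \<in> A \<times> B. forb y y'} + qdeg x"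
    by (simp add: card_cartesian_product)
  hence "real (card A * card B) \<le>
     real (card (good_pairs N \<Omega> x) + card (A \<inter> B) + card {(y, y') \<in> A \<times> B. forb y y'} + qdeg x)"
    by (simp only: of_nat_le_iff)
  thus ?thesis by simp
qed

text \<open>By symmetry of \<open>forb\<close> the count is taken from the side of \<open>B\<close>,
  so a degree bound on one side suffices. This matters for pairs with one end in the set of
  large-degree vertices, where \<open>fdeg\<close> is not controlled.\<close>

lemma card_forb_pairs_le:
  assumes "A \<subseteq> V" "B \<subseteq> V" "\<And>y. y \<in> B \<Longrightarrow> real (fdeg y) \<le> r"
  shows "real (card {(y, y') \<in> A \<times> B. forb y y'}) \<le> real (card B) * r"
proof -
  have fin: "finite A" "finite B" using assms finV by (auto intro: finite_subset)
  have "{(y, y') \<in> A \<times> B. forb y y'} = (\<lambda>(a, b). (b, a)) ` (SIGMA y':B. {y \<in> A. forb y y'})"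
    by force
  hence "card {(y, y') \<in> A \<times> B. forb y y'} \<le> card (SIGMA y':B. {y \<in> A. forb y y'})"
    using fin by (simp only:) (intro card_image_le finite_SigmaI, auto)
  also have "\<dots> = (\<Sum>y'\<in>B. card {y \<in> A. forb y y'})" using fin by (simp add: card_SigmaI)
  also have "\<dots> \<le> (\<Sum>y'\<in>B. fdeg y')"
  proof (rule sum_mono)
    fix y' show "card {y \<in> A. forb y y'} \<le> fdeg y'"
      unfolding fdeg_def by (rule card_mono) (use finV assms forb_sym in auto)
  qed
  finally have "real (card {(y, y') \<in> A \<times> B. forb y y'}) \<le> real (\<Sum>y'\<in>B. fdeg y')"
    by (simp only: of_nat_le_iff)
  also have "\<dots> \<le> (\<Sum>y'\<in>B. r)" unfolding of_nat_sum by (intro sum_mono assms(3))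
  finally show ?thesis by simp
qed

lemma card_forb_pairs_mono:
  assumes "N \<subseteq> V"
  shows "card {(y, y') \<in> N \<times> N. forb y y'} \<le> card {(y, y') \<in> V \<times> V. forb y y'}"
  by (rule card_mono) (use finV assms in \<open>auto intro: finite_subset[of _ "V \<times> V"]\<close>)

text \<open>Settles (M1) and (M3); for (M2) it bounds the total degree and the edges inside
  \<open>H\<close>. At a vertex of degree \<open>d x \<ge> 2 * t\<close> the diagonal costs at most
  1/8 of all pairs and the forbidden pairs at most 3/8. If \<open>Q\<close> also costs at most 1/8,
  then 3/8 of the pairs are good.\<close>

lemma sum_degrees_le:
  assumes S: "S \<subseteq> V" and t: "t \<ge> 4" and g: "\<gamma> \<le> 1/32"
  shows "(\<Sum>x\<in>S. real (card (nb x S))) \<le> 5 * t * card S + 4 * \<gamma> * t\<^sup>2"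
proof -
  define d where "d x = real (card (nb x S))" for x
  define X where "X = {x \<in> S. 2 * t \<le> d x \<and> 8 * real (qdeg x) \<le> (d x)\<^sup>2}"
  have finS: "finite S" using S finV by (rule finite_subset)
  have p: "3/8 * (d x)\<^sup>2 \<le> card (good_pairs (nb x S) (S \<times> S) x)" if "x \<in> X" for x
  proof -
    have "real (card (nb x S)) * real (card (nb x S)) - real (card (nb x S \<inter> nb x S))
     - real (card {(y, y') \<in> nb x S \<times> nb x S. forb y y'}) - real (qdeg x)
      \<le> real (card (good_pairs (nb x S) (S \<times> S) x))"
      using S nb_subset[of x S] by (intro card_good_pairs_ge) auto
    moreover have "real (card {(y, y') \<in> nb x S \<times> nb x S. forb y y'}) \<le> 3/2 * t\<^sup>2"
      using card_forb card_forb_pairs_mono[OF order_trans[OF nb_subset S], of x] by linarith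
    moreover have "4 * t\<^sup>2 \<le> (d x)\<^sup>2"
      using power_mono[of "2 * t" "d x" 2] that t by (simp add: X_def power_mult_distrib)
    moreover have "8 * d x \<le> d x * d x"
      using that t by (intro mult_right_mono) (auto simp: X_def)
    ultimately show ?thesis
      using that by (simp add: X_def d_def power2_eq_square)
  qed
  have "(\<Sum>x\<in>X. d x) \<le> 3 * t * card S"
  proof (rule sum_le_of_good_pairs[where N = "\<lambda>x. nb x S" and \<Omega> = "S \<times> S" and \<kappa> = "1/4" and c = "3/8"])
    fix x assume x: "x \<in> X"
    have dt: "t\<^sup>2 \<le> (d x)\<^sup>2" using x t by (intro power_mono) (auto simp: X_def)
    show "1/4 * (real (card (nb x S)))\<^sup>2 \<le> card (good_pairs (nb x S) (S \<times> S) x)"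
      using p[OF x] zero_le_power2[of "d x"] unfolding d_def by linarith
    show "1/4 * t\<^sup>2 \<le> card (good_pairs (nb x S) (S \<times> S) x)"
      using p[OF x] zero_le_power2[of "d x"] dt by linarith
    show "3/8 * (d x)\<^sup>2 \<le> card (good_pairs (nb x S) (S \<times> S) x)" by (rule p[OF x])
  next
    show "2 * t\<^sup>2 * real (card (S \<times> S)) \<le> 3/8 * (3 * t * card S)\<^sup>2"
      by (simp add: card_cartesian_product power_mult_distrib power2_eq_square)
        (use zero_le_square[of "t * card S"] in \<open>simp add: algebra_simps\<close>)
  qed (use S t g in \<open>auto simp: X_def d_def nb_def\<close>)
  \<comment> \<open>A vertex outside \<open>X\<close> has degree below \<open>2 * t\<close>, or many
    paths of \<open>Q\<close> through it; in the second case
    \<open>2 * t * d x \<le> (d x)\<^sup>2 < 8 * qdeg x\<close> charges its degree to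
    \<open>Q\<close>.\<close>
  moreover have "(\<Sum>x\<in>S - X. d x) \<le> 2 * t * card S + 4 * \<gamma> * t\<^sup>2"
  proof -
    have "(\<Sum>x\<in>S - X. d x) \<le> (\<Sum>x\<in>S - X. 2 * t + 4 / t * qdeg x)"
    proof (rule sum_mono)
      fix x assume x: "x \<in> S - X"
      show "d x \<le> 2 * t + 4 / t * qdeg x"
      proof (cases "2 * t \<le> d x")
        case True
        hence "(d x)\<^sup>2 < 8 * qdeg x" using x by (auto simp: X_def)
        moreover have "2 * t * d x \<le> (d x)\<^sup>2" unfolding power2_eq_square
          using True t by (intro mult_right_mono) auto
        ultimately have "t * d x \<le> 4 * qdeg x" by linarith
        hence "d x \<le> 4 / t * qdeg x" using t by (simp add: field_simps)
        thus ?thesis using t by linarith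
      next
        case False
        thus ?thesis using t by (simp add: add_increasing2)
      qed
    qed
    also have "\<dots> = 2 * t * card (S - X) + 4 / t * (\<Sum>x\<in>S - X. real (qdeg x))"
      by (simp add: sum.distrib sum_distrib_left)
    also have "\<dots> \<le> 2 * t * card S + 4 / t * (\<gamma> * t ^ 3)"
      using S t finS by (intro add_mono mult_left_mono sum_qdeg_le) (auto intro!: card_mono)
    also have "4 / t * (\<gamma> * t ^ 3) = 4 * \<gamma> * t\<^sup>2"
      using t by (simp add: power2_eq_square power3_eq_cube)
    finally show ?thesis .
  qed
  moreover have "(\<Sum>x\<in>S. d x) = (\<Sum>x\<in>S - X. d x) + (\<Sum>x\<in>X. d x)"
    using finS by (intro sum.subset_diff) (auto simp: X_def)
  ultimately show ?thesis unfolding d_def by (simp add: algebra_simps)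
qed

text \<open>A proportion \<open>\<zeta>/2\<close> of the pairs in a neighbourhood is good. If its
  size is within a factor \<open>1 \<plusminus> \<zeta>\<close> of \<open>t\<close>, then
  \<open>far\<close> leaves enough pairs outside \<open>forb\<close>; if it is larger,
  \<open>forb\<close> has too few pairs in total to fill it. The bound is linear in
  \<open>card H\<close>, hence negligible when \<open>H\<close> is a small part of
  \<open>V\<close>.\<close>

lemma sum_large_degrees_le:
  assumes X: "X \<subseteq> V" and H: "H \<subseteq> V" and z: "0 < \<zeta>" "\<zeta> \<le> 1/10"
    and t: "100 \<le> \<zeta> * t" and g: "\<gamma> \<le> \<zeta> / 64"
    and forb: "real (card {(x, y) \<in> V \<times> V. forb x y}) \<le> (1 + \<gamma>) * t\<^sup>2"
    and far: "\<And>N. N \<subseteq> V \<Longrightarrow> (1 - \<zeta>) * t \<le> card N \<Longrightarrow> card N \<le> (1 + \<zeta>) * t \<Longrightarrow>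
       real (card {(x, y) \<in> N \<times> N. forb x y}) \<le> (1 - 7 * \<zeta>) * t\<^sup>2"
    and q: "\<And>x. x \<in> X \<Longrightarrow> real (qdeg x) \<le> \<zeta> / 10 * t\<^sup>2"
    and d: "\<And>x. x \<in> X \<Longrightarrow> (1 - \<zeta>) * t \<le> card (nb x H)"
  shows "(\<Sum>x\<in>X. real (card (nb x H))) \<le> 2 / \<zeta> * t * card H"
proof -
  have p: "\<zeta>/2 * (real (card (nb x H)))\<^sup>2 \<le> card (good_pairs (nb x H) (H \<times> H) x)"
    and dt: "t\<^sup>2 \<le> 4 * (real (card (nb x H)))\<^sup>2" if x: "x \<in> X" for x
  proof -
    define e where "e = real (card (nb x H))"
    define F where "F = real (card {(y, y') \<in> nb x H \<times> nb x H. forb y y'})"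
    have NV: "nb x H \<subseteq> V" using H nb_subset by blast
    have p0: "e\<^sup>2 - e - F - real (qdeg x) \<le> card (good_pairs (nb x H) (H \<times> H) x)"
      using card_good_pairs_ge[of "nb x H" "nb x H" "H \<times> H" "nb x H" x] H NV nb_subset[of x H]
      by (auto simp: e_def F_def power2_eq_square)
    have tt: "(1 - \<zeta>) * t \<le> e" using d[OF x] by (simp add: e_def)
    have e1: "(1 - \<zeta>)\<^sup>2 * t\<^sup>2 \<le> e\<^sup>2"
      using power_mono[OF tt, of 2] z t_pos by (simp add: power_mult_distrib)
    have z2: "1 - 2 * \<zeta> \<le> (1 - \<zeta>)\<^sup>2" by (simp add: power2_eq_square algebra_simps)
    have e2: "(1 - 2 * \<zeta>) * t\<^sup>2 \<le> e\<^sup>2"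
      using mult_right_mono[OF z2, of "t\<^sup>2"] e1 by simp
    have z3: "(1 - 2 * \<zeta>) * t\<^sup>2 \<ge> 1/2 * t\<^sup>2" using z by (intro mult_right_mono) auto
    show "t\<^sup>2 \<le> 4 * (real (card (nb x H)))\<^sup>2"
      using e2 z3 zero_le_power2[of t] unfolding e_def by linarith
    have qx: "real (qdeg x) \<le> \<zeta> / 10 * t\<^sup>2" by (rule q[OF x])
    have "\<zeta> / 2 * e\<^sup>2 \<le> e\<^sup>2 - e - F - real (qdeg x)"
    proof (cases "e \<le> (1 + \<zeta>) * t")
      \<comment> \<open>To leading order
        \<open>(1 - 2 * \<zeta>) - (1 - 7 * \<zeta>) = 5 * \<zeta>\<close> times
        \<open>t\<^sup>2\<close> pairs survive, whereas only
        \<open>\<zeta>/2 * e\<^sup>2 \<le> \<zeta> * t\<^sup>2\<close> are required.\<close>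
      case True
      have F: "F \<le> (1 - 7 * \<zeta>) * t\<^sup>2"
        unfolding F_def using far[OF NV] True tt by (simp add: e_def)
      have "(1 + \<zeta>) * t \<le> 11/10 * t" using z t_pos by (intro mult_right_mono) auto
      hence et: "e \<le> 11/10 * t" using True by linarith
      have "100 * t \<le> \<zeta> * t\<^sup>2" using mult_right_mono[OF t, of t] t_pos by (simp add: power2_eq_square)
      hence e3: "e \<le> \<zeta> / 50 * t\<^sup>2" using et t_pos by linarith
      have "e\<^sup>2 \<le> (11/10 * t)\<^sup>2" using et by (intro power_mono) (auto simp: e_def)
      hence "e\<^sup>2 \<le> 2 * t\<^sup>2" by (simp add: power_mult_distrib power2_eq_square)
         (use zero_le_square[of t] in linarith)
      hence e4: "\<zeta> / 2 * e\<^sup>2 \<le> \<zeta> * t\<^sup>2" using mult_left_mono[of "e\<^sup>2" "2 * t\<^sup>2" "\<zeta>/2"] z by simp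
      have "0 \<le> \<zeta> * t\<^sup>2" using z by simp
      thus ?thesis using F e3 e4 e2 qx by (simp add: algebra_simps)
    next
      case False
      have "1 * t \<le> (1 + \<zeta>) * t" using z t_pos by (intro mult_right_mono) auto
      hence et: "t \<le> e" using False by linarith
      have t2: "t\<^sup>2 \<le> e\<^sup>2" using et t_pos by (intro power_mono) auto
      have F: "F \<le> (1 + \<gamma>) * t\<^sup>2"
        using forb card_forb_pairs_mono[OF NV] unfolding F_def by linarith
      \<comment> \<open>Together with \<open>e > (1 + \<zeta>) * t\<close> this gives
        \<open>t\<^sup>2 \<le> (1 - \<zeta>) * e\<^sup>2\<close>. So about
        \<open>\<zeta> * e\<^sup>2\<close> pairs are not forbidden, and the lower-order losses take
        less than half of them.\<close>
      have "1 \<le> (1 - \<zeta>) * (1 + \<zeta>)\<^sup>2"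
      proof -
        have "\<zeta> * \<zeta> \<le> \<zeta> * (1/10)" "\<zeta> * (\<zeta> * \<zeta>) \<le> \<zeta> * (1/10)"
          using z mult_mono[of \<zeta> "1/10" \<zeta> 1] by (auto intro!: mult_left_mono)
        moreover have "(1 - \<zeta>) * (1 + \<zeta>)\<^sup>2 = 1 + \<zeta> - \<zeta> * \<zeta> - \<zeta> * (\<zeta> * \<zeta>)"
          by (simp add: power2_eq_square algebra_simps)
        ultimately show ?thesis using z by linarith
      qed
      hence "t\<^sup>2 \<le> (1 - \<zeta>) * (1 + \<zeta>)\<^sup>2 * t\<^sup>2" using mult_right_mono[of 1 _ "t\<^sup>2"] by fastforce
      also have "\<dots> = (1 - \<zeta>) * ((1 + \<zeta>) * t)\<^sup>2" by (simp add: power_mult_distrib)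
      also have "\<dots> \<le> (1 - \<zeta>) * e\<^sup>2"
        using False z t_pos by (intro mult_left_mono power_mono) auto
      finally have t3: "t\<^sup>2 \<le> (1 - \<zeta>) * e\<^sup>2" .
      have "100 * e \<le> \<zeta> * t * e" using t by (intro mult_right_mono) (auto simp: e_def)
      also have "\<dots> \<le> \<zeta> * e * e" using et z by (intro mult_right_mono mult_left_mono) (auto simp: e_def)
      finally have e3: "e \<le> \<zeta> / 100 * e\<^sup>2" by (simp add: power2_eq_square)
      have g3: "\<gamma> * t\<^sup>2 \<le> \<zeta>/64 * e\<^sup>2" using g t2 gamma_nonneg z by (intro mult_mono) auto
      have q3: "\<zeta> / 10 * t\<^sup>2 \<le> \<zeta> / 10 * e\<^sup>2" using t2 z by (intro mult_left_mono) auto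
      have "0 \<le> \<zeta> * e\<^sup>2" using z by simp
      thus ?thesis using F e3 t3 g3 q3 qx by (simp add: algebra_simps)
    qed
    thus "\<zeta>/2 * (real (card (nb x H)))\<^sup>2 \<le> card (good_pairs (nb x H) (H \<times> H) x)"
      using p0 by (simp add: e_def)
  qed
  show ?thesis
  proof (rule sum_le_of_good_pairs[where N = "\<lambda>x. nb x H" and \<Omega> = "H \<times> H" and \<kappa> = "\<zeta>/8" and c = "\<zeta>/2"])
    fix x assume x: "x \<in> X"
    have "0 \<le> \<zeta> * (real (card (nb x H)))\<^sup>2" using z by simp
    thus "\<zeta>/8 * (real (card (nb x H)))\<^sup>2 \<le> card (good_pairs (nb x H) (H \<times> H) x)"
      using p[OF x] by linarith
    have "\<zeta>/8 * t\<^sup>2 \<le> \<zeta>/8 * (4 * (real (card (nb x H)))\<^sup>2)"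
      using dt[OF x] z by (intro mult_left_mono) auto
    thus "\<zeta>/8 * t\<^sup>2 \<le> card (good_pairs (nb x H) (H \<times> H) x)"
      using p[OF x] by linarith
    show "\<zeta>/2 * (real (card (nb x H)))\<^sup>2 \<le> card (good_pairs (nb x H) (H \<times> H) x)" by (rule p[OF x])
  next
    have "\<zeta>/2 * (2 / \<zeta> * t * card H)\<^sup>2 = (2 * t\<^sup>2 * (card H)\<^sup>2) * (1 / \<zeta>)"
      using z by (simp add: power_mult_distrib power_divide power2_eq_square)
    moreover have "(2 * t\<^sup>2 * (card H)\<^sup>2) * 1 \<le> (2 * t\<^sup>2 * (card H)\<^sup>2) * (1 / \<zeta>)"
      using z by (intro mult_left_mono) auto
    ultimately show "2 * t\<^sup>2 * real (card (H \<times> H)) \<le> \<zeta>/2 * (2 / \<zeta> * t * card H)\<^sup>2"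
      by (simp add: card_cartesian_product power2_eq_square)
  qed (use X H z g t_pos in \<open>auto simp: nb_def\<close>)
qed

text \<open>Pairs with one end in \<open>H\<close> and one in \<open>L\<close> form a set
  \<open>\<Omega>\<close> of only \<open>card H * card L\<close> elements. A vertex with many
  neighbours in both classes would have many good pairs there, since small degrees on
  \<open>L\<close> make forbidden pairs and \<open>Q\<close> cost at most 1/12 each.\<close>

lemma sum_min_degrees_le:
  assumes X: "X \<subseteq> V" and H: "H \<subseteq> V" and L: "L \<subseteq> V" "H \<inter> L = {}"
    and th: "0 < \<theta>" "\<theta> \<le> 1" and g: "64 * \<gamma> \<le> \<theta>\<^sup>2"
    and f: "\<And>y. y \<in> L \<Longrightarrow> real (fdeg y) \<le> \<theta> / 12 * t"
    and q: "\<And>x. x \<in> X \<Longrightarrow> real (qdeg x) \<le> \<theta>\<^sup>2 / 12 * t\<^sup>2"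
    and b: "b \<ge> 0" "4 * t\<^sup>2 * (real (card H) * real (card L)) \<le> b\<^sup>2"
  shows "(\<Sum>x\<in>X. real (min (card (nb x H)) (card (nb x L)))) \<le> \<theta> * t * card X + b"
proof -
  define m where "m x = min (card (nb x H)) (card (nb x L))" for x
  define Y where "Y = {x \<in> X. \<theta> * t \<le> m x}"
  have finX: "finite X" using X finV by (rule finite_subset)
  \<comment> \<open>Both neighbourhoods are truncated to the smaller size. Otherwise
    \<open>(card (N x))\<^sup>2\<close> could greatly exceed the number of pairs between them, and
    the proportion of good pairs required by the counting lemma would fail.\<close>
  have "\<exists>A B. A \<subseteq> nb x H \<and> B \<subseteq> nb x L \<and> card A = m x \<and> card B = m x" for x
    using obtain_subset_with_card_n[of "m x" "nb x H"] obtain_subset_with_card_n[of "m x" "nb x L"]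
    unfolding m_def by (metis min.cobounded1 min.cobounded2)
  then obtain A B where AB: "A x \<subseteq> nb x H" "B x \<subseteq> nb x L" "card (A x) = m x" "card (B x) = m x" for x
    by metis
  define N where "N x = A x \<union> B x" for x
  have ABH: "A x \<subseteq> H" "B x \<subseteq> L" for x using AB nb_subset by blast+
  have cN: "card (N x) = 2 * m x" for x
  proof -
    have "A x \<inter> B x = {}" using ABH[of x] L(2) by blast
    moreover have "finite (A x)" "finite (B x)" using ABH[of x] H L finV by (meson finite_subset)+
    ultimately show ?thesis unfolding N_def by (simp add: card_Un_disjoint AB)
  qed
  have p: "1/2 * (real (m x))\<^sup>2 \<le> card (good_pairs (N x) (H \<times> L) x)" if x: "x \<in> Y" for x
  proof -
    have mt: "\<theta> * t \<le> m x" using x by (simp add: Y_def)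
    have "real (card (A x)) * real (card (B x)) - real (card (A x \<inter> B x))
     - real (card {(y, y') \<in> A x \<times> B x. forb y y'}) - real (qdeg x)
      \<le> real (card (good_pairs (N x) (H \<times> L) x))"
      using ABH[of x] H L unfolding N_def by (intro card_good_pairs_ge) auto
    moreover have "A x \<inter> B x = {}" using ABH[of x] L(2) by blast
    moreover have "real (card {(y, y') \<in> A x \<times> B x. forb y y'}) \<le> real (card (B x)) * (\<theta> / 12 * t)"
      using ABH[of x] H L f by (intro card_forb_pairs_le) auto
    moreover have "real (m x) * (\<theta> * t) \<le> real (m x) * real (m x)"
      using mt by (intro mult_left_mono) auto
    moreover have "\<theta>\<^sup>2 * t\<^sup>2 \<le> (real (m x))\<^sup>2"
      unfolding power_mult_distrib[symmetric] using mt th t_pos by (intro power_mono) auto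
    moreover have "real (qdeg x) \<le> \<theta>\<^sup>2 / 12 * t\<^sup>2" using q x by (simp add: Y_def)
    ultimately show ?thesis
      by (simp add: AB power2_eq_square)
  qed
  have "(\<Sum>x\<in>Y. real (m x)) \<le> b"
  proof (rule sum_le_of_good_pairs[where N = N and \<Omega> = "H \<times> L" and \<kappa> = "\<theta>\<^sup>2/8" and c = "1/2"])
    fix x assume x: "x \<in> Y"
    have mt: "\<theta> * t \<le> m x" using x by (simp add: Y_def)
    have t2: "\<theta>\<^sup>2 \<le> 1" using th by (simp add: power_le_one)
    have "\<theta>\<^sup>2/8 * (real (card (N x)))\<^sup>2 \<le> 1/8 * (real (card (N x)))\<^sup>2"
      using t2 by (intro mult_right_mono) auto
    thus "\<theta>\<^sup>2/8 * (real (card (N x)))\<^sup>2 \<le> card (good_pairs (N x) (H \<times> L) x)"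
      using p[OF x] by (simp add: cN power_mult_distrib)
    have "(\<theta> * t)\<^sup>2 \<le> (real (m x))\<^sup>2" using mt th t_pos by (intro power_mono) auto
    thus "\<theta>\<^sup>2/8 * t\<^sup>2 \<le> card (good_pairs (N x) (H \<times> L) x)"
      using p[OF x] zero_le_power2[of "real (m x)"] by (simp add: power_mult_distrib)
    show "1/2 * (real (m x))\<^sup>2 \<le> card (good_pairs (N x) (H \<times> L) x)" by (rule p[OF x])
    show "N x \<subseteq> nb x V" using AB[of x] H L by (auto simp: N_def nb_def)
  next
    show "2 * t\<^sup>2 * real (card (H \<times> L)) \<le> 1/2 * b\<^sup>2"
      using b(2) by (simp add: card_cartesian_product)
    show "\<theta>\<^sup>2 / 8 \<le> 1" using th power_le_one[of \<theta> 2] by simp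
  qed (use X H L th g b in \<open>auto simp: Y_def\<close>)
  moreover have "(\<Sum>x\<in>X - Y. real (m x)) \<le> (\<Sum>x\<in>X - Y. \<theta> * t)"
    by (rule sum_mono) (auto simp: Y_def)
  moreover have "(\<Sum>x\<in>X - Y. \<theta> * t) \<le> \<theta> * t * card X"
    using th t_pos finX by (simp add: card_mono mult.commute)
  moreover have "(\<Sum>x\<in>X. real (m x)) = (\<Sum>x\<in>X - Y. real (m x)) + (\<Sum>x\<in>Y. real (m x))"
    using finX by (intro sum.subset_diff) (auto simp: Y_def)
  ultimately show ?thesis unfolding m_def by linarith
qed

text \<open>With \<open>fdeg\<close> and \<open>qdeg\<close> small throughout \<open>S\<close>, the
  diagonal, \<open>forb\<close> and \<open>Q\<close> each cost at most 1/12 of the pairs, so at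
  least 2/3 are good. This improves the constant to the square root of 3, below 7/4; vertices of
  degree under \<open>\<theta> * t\<close> add 1/20. The point is to stay below 2.\<close>

lemma sum_inner_degrees_le:
  assumes S: "S \<subseteq> V" and th: "0 < \<theta>" "\<theta> \<le> 1/20" and g: "64 * \<gamma> \<le> \<theta>\<^sup>2" and t: "12 \<le> \<theta> * t"
    and f: "\<And>y. y \<in> S \<Longrightarrow> real (fdeg y) \<le> \<theta> / 12 * t"
    and q: "\<And>x. x \<in> S \<Longrightarrow> real (qdeg x) \<le> \<theta>\<^sup>2 / 12 * t\<^sup>2"
  shows "(\<Sum>x\<in>S. real (card (nb x S))) \<le> 9/5 * t * card S"
proof -
  define d where "d x = real (card (nb x S))" for x
  define X where "X = {x \<in> S. \<theta> * t \<le> d x}"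
  have finS: "finite S" using S finV by (rule finite_subset)
  have p: "2/3 * (d x)\<^sup>2 \<le> card (good_pairs (nb x S) (S \<times> S) x)" if x: "x \<in> X" for x
  proof -
    have mt: "\<theta> * t \<le> d x" using x by (simp add: X_def)
    have "real (card (nb x S)) * real (card (nb x S)) - real (card (nb x S \<inter> nb x S))
     - real (card {(y, y') \<in> nb x S \<times> nb x S. forb y y'}) - real (qdeg x)
      \<le> real (card (good_pairs (nb x S) (S \<times> S) x))"
      using S nb_subset[of x S] by (intro card_good_pairs_ge) auto
    moreover have "real (card {(y, y') \<in> nb x S \<times> nb x S. forb y y'}) \<le> d x * (\<theta> / 12 * t)"
      unfolding d_def using S nb_subset[of x S] f by (intro card_forb_pairs_le) auto
    moreover have "d x * (\<theta> * t) \<le> d x * d x"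
      using mt by (intro mult_left_mono) (auto simp: d_def)
    moreover have "\<theta>\<^sup>2 * t\<^sup>2 \<le> (d x)\<^sup>2"
      unfolding power_mult_distrib[symmetric] using mt th t_pos by (intro power_mono) auto
    moreover have "real (qdeg x) \<le> \<theta>\<^sup>2 / 12 * t\<^sup>2" using q x by (simp add: X_def)
    moreover have "12 * d x \<le> d x * d x"
      using mt t by (intro mult_right_mono) (auto simp: d_def)
    ultimately show ?thesis
      by (simp add: d_def power2_eq_square)
  qed
  have "(\<Sum>x\<in>X. d x) \<le> 7/4 * t * card S"
  proof (rule sum_le_of_good_pairs[where N = "\<lambda>x. nb x S" and \<Omega> = "S \<times> S" and \<kappa> = "\<theta>\<^sup>2/8" and c = "2/3"])
    fix x assume x: "x \<in> X"
    have mt: "\<theta> * t \<le> d x" using x by (simp add: X_def)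
    have t2: "\<theta>\<^sup>2 \<le> 1" using th by (simp add: power_le_one)
    have "\<theta>\<^sup>2/8 * (d x)\<^sup>2 \<le> 2/3 * (d x)\<^sup>2"
      using t2 by (intro mult_right_mono) auto
    thus "\<theta>\<^sup>2/8 * (real (card (nb x S)))\<^sup>2 \<le> card (good_pairs (nb x S) (S \<times> S) x)"
      using p[OF x] unfolding d_def by linarith
    have "(\<theta> * t)\<^sup>2 \<le> (d x)\<^sup>2" using mt th t_pos by (intro power_mono) auto
    thus "\<theta>\<^sup>2/8 * t\<^sup>2 \<le> card (good_pairs (nb x S) (S \<times> S) x)"
      using p[OF x] zero_le_power2[of "d x"] by (simp add: power_mult_distrib)
    show "2/3 * (d x)\<^sup>2 \<le> card (good_pairs (nb x S) (S \<times> S) x)" by (rule p[OF x])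
    show "nb x S \<subseteq> nb x V" using S by (auto simp: nb_def)
  next
    show "2 * t\<^sup>2 * real (card (S \<times> S)) \<le> 2/3 * (7/4 * t * card S)\<^sup>2"
      by (simp add: card_cartesian_product power_mult_distrib power2_eq_square)
        (use zero_le_square[of "t * card S"] in \<open>simp add: algebra_simps\<close>)
    show "\<theta>\<^sup>2 / 8 \<le> 1" using th power_le_one[of \<theta> 2] by simp
  qed (use S th g t_pos in \<open>auto simp: X_def d_def\<close>)
  moreover have "(\<Sum>x\<in>S - X. d x) \<le> (\<Sum>x\<in>S - X. \<theta> * t)"
    by (rule sum_mono) (auto simp: X_def)
  moreover have "(\<Sum>x\<in>S - X. \<theta> * t) \<le> 1/20 * t * card S"
  proof -
    have "(\<Sum>x\<in>S - X. \<theta> * t) = \<theta> * t * card (S - X)" by simp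
    also have "\<dots> \<le> 1/20 * t * card S"
      using th t_pos finS by (intro mult_mono) (auto simp: card_mono)
    finally show ?thesis .
  qed
  moreover have "(\<Sum>x\<in>S. d x) = (\<Sum>x\<in>S - X. d x) + (\<Sum>x\<in>X. d x)"
    using finS by (intro sum.subset_diff) (auto simp: X_def)
  ultimately show ?thesis unfolding d_def by linarith
qed

section \<open>Splitting the degree sum over vertex classes, and the degree bound for (M2)\<close>

lemma sum_nb_swap:
  assumes "A \<subseteq> V" "B \<subseteq> V"
  shows "(\<Sum>x\<in>A. real (card (nb x B))) = (\<Sum>x\<in>B. real (card (nb x A)))"
proof -
  have fin: "finite A" "finite B" using assms finV by (auto intro: finite_subset)
  have "(\<Sum>x\<in>A. real (card (nb x B))) = (\<Sum>x\<in>A. \<Sum>y\<in>B. of_bool (adj x y))"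
    using fin by (intro sum.cong) (auto simp: nb_def of_bool_def sum.If_cases Int_def)
  also have "\<dots> = (\<Sum>y\<in>B. \<Sum>x\<in>A. of_bool (adj x y))" by (rule sum.swap)
  also have "\<dots> = (\<Sum>y\<in>B. \<Sum>x\<in>A. of_bool (adj y x))"
    by (intro sum.cong refl) (use adj_sym in auto)
  also have "\<dots> = (\<Sum>x\<in>B. real (card (nb x A)))"
    using fin by (intro sum.cong) (auto simp: nb_def of_bool_def sum.If_cases Int_def)
  finally show ?thesis .
qed

lemma card_nb_Un:
  assumes "A \<subseteq> V" "B \<subseteq> V" "A \<inter> B = {}"
  shows "real (card (nb x (A \<union> B))) = real (card (nb x A)) + real (card (nb x B))"
proof -
  have "nb x (A \<union> B) = nb x A \<union> nb x B" "nb x A \<inter> nb x B = {}" using assms by (auto simp: nb_def)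
  thus ?thesis using assms by (simp add: card_Un_disjoint finite_nb)
qed

lemma sum_card_nb:
  assumes "S \<subseteq> V"
  shows "(\<Sum>x\<in>S. real (card (nb x S))) = real (card {(x, y) \<in> S \<times> S. adj x y})"
proof -
  have fin: "finite S" using assms finV by (rule finite_subset)
  have "{(x, y) \<in> S \<times> S. adj x y} = (SIGMA x:S. nb x S)" by (auto simp: nb_def)
  thus ?thesis using fin by (simp add: card_SigmaI nb_def)
qed

text \<open>\<open>V\<close> is split into \<open>H\<close> (large degree), \<open>R\<close> (the
  remaining vertices with large \<open>fdeg\<close> or \<open>qdeg\<close>) and \<open>L\<close>.
  Edges inside \<open>H\<close> or at \<open>R\<close> are negligible. In \<open>L\<close>, vertices
  leaning towards \<open>H\<close> send about \<open>(1 - \<zeta>) * t\<close> edges there on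
  average at most, which count twice in the sum, and those leaning towards \<open>L\<close> have
  average inner degree at most \<open>9/5 * t\<close>. Both contribute at most
  \<open>2 * (1 - \<zeta>) * t\<close> per vertex.\<close>

lemma sum_degrees_le_of_far:
  assumes z: "0 < \<zeta>" "\<zeta> \<le> 1/10" and th: "\<theta> = \<zeta> / 40" and g: "\<gamma> \<le> \<theta>\<^sup>2 / 1000"
    and forb: "real (card {(x, y) \<in> V \<times> V. forb x y}) \<le> (1 + \<gamma>) * t\<^sup>2"
    and far: "\<And>N. N \<subseteq> V \<Longrightarrow> (1 - \<zeta>) * t \<le> card N \<Longrightarrow> card N \<le> (1 + \<zeta>) * t \<Longrightarrow>
       real (card {(x, y) \<in> N \<times> N. forb x y}) \<le> (1 - 7 * \<zeta>) * t\<^sup>2"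
    and t: "t \<le> \<theta> ^ 4 / 576 * card V"
  shows "(\<Sum>x\<in>V. real (card (nb x V))) \<le> (2 - \<zeta>) * t * card V"
proof -
  define n where "n = real (card V)"
  define K where "K = 24 / \<theta>\<^sup>2"
  have th0: "0 < \<theta>" "\<theta> \<le> 1/400" using z th by auto
  have th2: "\<theta>\<^sup>2 \<le> 1/400 * \<theta>" "\<theta>\<^sup>2 > 0" using th0 by (auto simp: power2_eq_square)
  have th4: "\<theta> ^ 4 \<le> 1" using th0 by (simp add: power_le_one)
  have n0: "n > 0"
  proof (rule ccontr)
    assume "\<not> n > 0"
    hence "card V = 0" by (simp add: n_def)
    thus False using t t_pos by simp
  qed
  have n1: "n \<ge> 1" using n0 by (simp add: n_def)
  have tn: "t \<le> \<theta> ^ 4 / 576 * n" using t by (simp add: n_def)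
  have "\<theta> ^ 4 / 576 * n \<le> 1 * n" using th4 n0 by (intro mult_right_mono) auto
  hence tn1: "t \<le> n" using tn by linarith
  \<comment> \<open>Non-emptiness of \<open>V\<close> and \<open>card_V\<close> force
    \<open>t\<close> to be large in terms of \<open>\<theta>\<close>; all lower bounds on
    \<open>t\<close> come from here.\<close>
  have "1 \<le> \<gamma> * t\<^sup>2" using card_V n1 by (simp add: n_def)
  also have "\<dots> \<le> \<theta>\<^sup>2 / 1000 * t\<^sup>2" using g by (intro mult_right_mono) auto
  finally have "12\<^sup>2 \<le> (\<theta> * t)\<^sup>2" by (simp add: power_mult_distrib)
  hence tt: "12 \<le> \<theta> * t" by (rule power2_le_imp_le) (use th0 t_pos in auto)
  have zt: "100 \<le> \<zeta> * t" using tt by (simp add: th)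
  have "\<theta> * t \<le> 1 * t" using th0 t_pos by (intro mult_right_mono) auto
  hence t4: "t \<ge> 4" using tt by linarith
  have g1: "\<gamma> \<le> 1/4000 * \<theta>" using g th2 th0 by linarith
  have g2: "\<gamma> \<le> 1/32" "\<gamma> \<le> \<zeta>/64" using g1 th0 th by auto
  have g3: "64 * \<gamma> \<le> \<theta>\<^sup>2" using g th2 by linarith
  have tn2: "t\<^sup>2 \<le> t * n" using tn1 t_pos by (simp add: power2_eq_square)
  have gt: "4 * \<gamma> * t\<^sup>2 \<le> 4 * (1/4000 * \<theta>) * (t * n)"
    using g1 tn2 gamma_nonneg th0 by (intro mult_mono) auto
  have tn0: "0 < t * n" using t_pos n0 by simp
  have thtn: "0 < \<theta> * (t * n)" "\<theta> * (t * n) \<le> 1/400 * (t * n)"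
    using tn0 th0 mult_right_mono[of \<theta> "1/400" "t * n"] by auto
  define deg where "deg x = real (card (nb x V))" for x
  have tot: "(\<Sum>x\<in>V. deg x) \<le> 6 * (t * n)"
    using sum_degrees_le[OF order_refl t4 g2(1)] gt thtn by (simp add: deg_def n_def)
  \<comment> \<open>As the total degree is at most \<open>6 * (t * n)\<close>, the choice of
    \<open>K\<close> gives \<open>card H \<le> 6 * n / K = \<theta>\<^sup>2 / 4 * n\<close>.\<close>
  define H where "H = {x \<in> V. K * t < deg x}"
  \<comment> \<open>The thresholds are those under which the lemmas on minima and on inner degrees
    apply; averaging bounds \<open>card B\<close> by a multiple of
    \<open>t / \<theta>\<close>.\<close>
  define B where "B = {x \<in> V. real (fdeg x) > \<theta> / 12 * t \<or> real (qdeg x) > \<theta>\<^sup>2 / 12 * t\<^sup>2}"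
  define R where "R = B - H"
  define L where "L = V - H - B"
  have sub: "H \<subseteq> V" "R \<subseteq> V" "L \<subseteq> V" "B \<subseteq> V" by (auto simp: H_def R_def B_def L_def)
  have fin: "finite H" "finite R" "finite L" "finite B" using sub finV by (auto intro: finite_subset)
  have part: "V = H \<union> (R \<union> L)" "H \<inter> (R \<union> L) = {}" "R \<inter> L = {}" "H \<inter> L = {}" "H \<inter> R = {}"
    using sub by (auto simp: R_def L_def)
  have K0: "K > 0" using th2 by (simp add: K_def)
  have cH: "card H \<le> \<theta>\<^sup>2 / 4 * n"
  proof -
    have "(\<Sum>x\<in>H. K * t) \<le> (\<Sum>x\<in>H. deg x)" by (rule sum_mono) (auto simp: H_def)
    also have "\<dots> \<le> (\<Sum>x\<in>V. deg x)" using sub finV by (intro sum_mono2) (auto simp: deg_def)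
    finally have "card H * (K * t) \<le> 6 * (t * n)" using tot by simp
    hence "card H * K \<le> 6 * n" using t_pos by (simp add: algebra_simps)
    thus ?thesis using th2 by (simp add: K_def field_simps)
  qed
  have cB: "card B \<le> 19 / \<theta> * t"
  proof -
    have "(\<Sum>x\<in>B. 1) \<le> (\<Sum>x\<in>B. 12 / (\<theta> * t) * fdeg x + 12 / (\<theta>\<^sup>2 * t\<^sup>2) * qdeg x)"
    proof (rule sum_mono)
      fix x assume "x \<in> B"
      then consider "real (fdeg x) > \<theta> / 12 * t" | "real (qdeg x) > \<theta>\<^sup>2 / 12 * t\<^sup>2" by (auto simp: B_def)
      thus "1 \<le> 12 / (\<theta> * t) * fdeg x + 12 / (\<theta>\<^sup>2 * t\<^sup>2) * qdeg x"
      proof cases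
        case 1
        hence "1 \<le> 12 / (\<theta> * t) * fdeg x" using th0 t_pos by (simp add: field_simps)
        thus ?thesis by (simp add: add_increasing2)
      next
        case 2
        hence "1 \<le> 12 / (\<theta>\<^sup>2 * t\<^sup>2) * qdeg x" using th0 t_pos by (simp add: field_simps)
        moreover have "0 \<le> 12 / (\<theta> * t) * fdeg x" using th0 t_pos by simp
        ultimately show ?thesis by linarith
      qed
    qed
    also have "\<dots> = 12 / (\<theta> * t) * (\<Sum>x\<in>B. real (fdeg x)) + 12 / (\<theta>\<^sup>2 * t\<^sup>2) * (\<Sum>x\<in>B. real (qdeg x))"
      by (simp add: sum.distrib sum_distrib_left)
    also have "\<dots> \<le> 12 / (\<theta> * t) * (3/2 * t\<^sup>2) + 12 / (\<theta>\<^sup>2 * t\<^sup>2) * (\<gamma> * t ^ 3)"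
      using th0 t_pos sub by (intro add_mono mult_left_mono sum_fdeg_le sum_qdeg_le) auto
    also have "\<dots> = 18 / \<theta> * t + 12 * \<gamma> / \<theta>\<^sup>2 * t"
      using th0 t_pos by (simp add: field_simps power2_eq_square power3_eq_cube)
    also have "\<dots> \<le> 18 / \<theta> * t + 1 / \<theta> * t"
    proof -
      have "12 * \<gamma> \<le> \<theta>\<^sup>2" using g3 gamma_nonneg by linarith
      hence "12 * \<gamma> / \<theta>\<^sup>2 \<le> 1" using th2 by simp
      also have "1 \<le> 1 / \<theta>" using th0 by simp
      finally show ?thesis using t_pos by (intro add_mono mult_right_mono order_refl) auto
    qed
    finally show ?thesis by (simp add: field_simps)
  qed
  define nR where "nR = (\<Sum>x\<in>R. deg x)"
  \<comment> \<open>Each vertex of \<open>R\<close> has degree at most \<open>K * t\<close>, and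
    there are at most \<open>19 / \<theta> * t\<close> of them. The bound on \<open>t\<close>
    relative to \<open>card V\<close> makes the product at most 24 * 19 / 576 times
    \<open>\<theta> * (t * n)\<close>.\<close>
  have nR: "nR \<le> \<theta> * (t * n)"
  proof -
    have "nR \<le> (\<Sum>x\<in>R. K * t)" unfolding nR_def by (rule sum_mono) (auto simp: R_def H_def B_def)
    also have "\<dots> = K * t * card R" by simp
    also have "\<dots> \<le> K * t * (19 / \<theta> * t)"
      using cB card_mono[OF fin(4), of R] K0 t_pos by (intro mult_left_mono) (auto simp: R_def)
    also have "\<dots> \<le> K * t * (19 / \<theta> * (\<theta> ^ 4 / 576 * n))"
      using tn K0 t_pos th0 by (intro mult_left_mono) auto
    also have "\<dots> = (456 / 576) * (\<theta> * (t * n))"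
      using th0 by (simp add: K_def field_simps power2_eq_square power4_eq_xxxx)
    finally show ?thesis using thtn by linarith
  qed
  define s where "s A B = (\<Sum>x\<in>A. real (card (nb x B)))" for A B
  have sUn: "s A (C \<union> D) = s A C + s A D" if "C \<subseteq> V" "D \<subseteq> V" "C \<inter> D = {}" for A C D
    using that by (simp add: s_def card_nb_Un sum.distrib)
  have sUn1: "s (C \<union> D) A = s C A + s D A" if "C \<subseteq> V" "D \<subseteq> V" "C \<inter> D = {}" for A C D
    unfolding s_def by (rule sum.union_disjoint) (use that finV in \<open>auto intro: finite_subset\<close>)
  have swap: "s A C = s C A" if "A \<subseteq> V" "C \<subseteq> V" for A C
    using sum_nb_swap[OF that] by (simp add: s_def)
  have s0: "s A C \<ge> 0" for A C by (simp add: s_def sum_nonneg)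
  have sV: "s A V = s A H + s A R + s A L" for A
    using sUn[of H "R \<union> L" A] sUn[of R L A] part sub by simp
  have VV: "s V V = s H V + s R V + s L V"
    using sUn1[of H "R \<union> L" V] sUn1[of R L V] part sub by simp
  have nR': "s R V = nR" by (simp add: s_def nR_def deg_def)
  have HH: "s H H \<le> \<theta> * (t * n)"
  proof -
    have "s H H \<le> 5 * t * card H + 4 * \<gamma> * t\<^sup>2"
      unfolding s_def by (rule sum_degrees_le[OF sub(1) t4 g2(1)])
    also have "5 * t * card H \<le> 5 * t * (\<theta>\<^sup>2 / 4 * n)" using cH t_pos by (intro mult_left_mono) auto
    also have "5 * t * (\<theta>\<^sup>2 / 4 * n) = 5/4 * (\<theta>\<^sup>2 * (t * n))" by simp
    also have "\<theta>\<^sup>2 * (t * n) \<le> (1/400 * \<theta>) * (t * n)" using th2 tn0 by (intro mult_right_mono) auto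
    finally show ?thesis using gt thtn by (simp add: mult.commute[of n t])
  qed
  define dH where "dH x = card (nb x H)" for x
  define dL where "dL x = card (nb x L)" for x
  \<comment> \<open>The minimum of the two degrees is \<open>dL\<close> on \<open>V1\<close> and
    \<open>dH\<close> on \<open>V2\<close>. Hence the bound on \<open>m L\<close> says that
    \<open>V1\<close> sends few edges into \<open>L\<close> and \<open>V2\<close> few into
    \<open>H\<close>.\<close>
  define V1 where "V1 = {x \<in> L. dL x < dH x}"
  define V2 where "V2 = {x \<in> L. dH x \<le> dL x}"
  have V12: "V1 \<union> V2 = L" "V1 \<inter> V2 = {}" "V1 \<subseteq> V" "V2 \<subseteq> V" "V1 \<subseteq> L" "V2 \<subseteq> L"
    using sub by (auto simp: V1_def V2_def)
  have fin12: "finite V1" "finite V2" using V12 fin by (auto intro: finite_subset)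
  have Lf: "real (fdeg y) \<le> \<theta> / 12 * t" and Lq: "real (qdeg y) \<le> \<theta>\<^sup>2 / 12 * t\<^sup>2" if "y \<in> L" for y
    using that by (auto simp: L_def B_def)
  define m where "m A = (\<Sum>x\<in>A. real (min (dH x) (dL x)))" for A
  have mL: "m L \<le> 2 * (\<theta> * (t * n))"
  proof -
    have "m L \<le> \<theta> * t * card L + \<theta> * (t * n)"
      unfolding m_def dH_def dL_def
    proof (rule sum_min_degrees_le)
      have "real (card L) \<le> n" using card_mono[OF finV sub(3)] by (simp add: n_def)
      hence "4 * t\<^sup>2 * (real (card H) * real (card L)) \<le> 4 * t\<^sup>2 * ((\<theta>\<^sup>2 / 4 * n) * n)"
        using cH n0 by (intro mult_left_mono mult_mono) auto
      thus "4 * t\<^sup>2 * (real (card H) * real (card L)) \<le> (\<theta> * (t * n))\<^sup>2"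
        by (simp add: power_mult_distrib power2_eq_square mult.assoc mult.left_commute)
    qed (use sub part th0 g3 Lf Lq thtn in auto)
    moreover have "\<theta> * t * card L \<le> \<theta> * t * n"
      using card_mono[OF finV sub(3)] th0 t_pos by (intro mult_left_mono) (auto simp: n_def)
    ultimately show ?thesis by simp
  qed
  have mL': "m L = m V1 + m V2"
    unfolding m_def V12(1)[symmetric] by (rule sum.union_disjoint) (use fin12 V12 in auto)
  have s2H: "s V2 H = m V2" and s1L: "s V1 L = m V1"
    unfolding s_def m_def by (intro sum.cong refl; auto simp: V1_def V2_def dH_def dL_def)+
  \<comment> \<open>Only vertices with at least \<open>(1 - \<zeta>) * t\<close> neighbours in
    \<open>H\<close> can break the main term. Their total is at most
    \<open>2 / \<zeta> * t * card H\<close>, which is below \<open>\<theta> * (t * n)\<close>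
    because \<open>H\<close> is small.\<close>
  have s1H: "s V1 H \<le> (1 - \<zeta>) * t * card V1 + \<theta> * (t * n)"
  proof -
    define X where "X = {x \<in> V1. (1 - \<zeta>) * t \<le> dH x}"
    have "(\<Sum>x\<in>X. real (dH x)) \<le> 2 / \<zeta> * t * card H"
      unfolding dH_def
    proof (rule sum_large_degrees_le[OF _ sub(1) z zt g2(2) forb far])
      fix x assume "x \<in> X"
      hence "x \<in> L" using V12 by (auto simp: X_def)
      moreover have "\<theta>\<^sup>2 / 12 * t\<^sup>2 \<le> \<zeta> / 10 * t\<^sup>2"
        using th2 th th0 by (intro mult_right_mono) auto
      ultimately show "real (qdeg x) \<le> \<zeta> / 10 * t\<^sup>2" using Lq[of x] by linarith
    qed (use V12 in \<open>auto simp: X_def dH_def\<close>)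
    also have "\<dots> \<le> 2 / \<zeta> * t * (\<theta>\<^sup>2 / 4 * n)" using cH z t_pos by (intro mult_left_mono) auto
    also have "\<dots> = 1/80 * (\<theta> * (t * n))" using z by (simp add: th field_simps power2_eq_square)
    finally have "(\<Sum>x\<in>X. real (dH x)) \<le> \<theta> * (t * n)" using thtn by linarith
    moreover have "(\<Sum>x\<in>V1 - X. real (dH x)) \<le> (\<Sum>x\<in>V1 - X. (1 - \<zeta>) * t)"
      by (rule sum_mono) (auto simp: X_def)
    moreover have "(\<Sum>x\<in>V1 - X. (1 - \<zeta>) * t) \<le> (1 - \<zeta>) * t * card V1"
    proof -
      have "(\<Sum>x\<in>V1 - X. (1 - \<zeta>) * t) = (1 - \<zeta>) * t * card (V1 - X)" by simp
      also have "\<dots> \<le> (1 - \<zeta>) * t * card V1"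
        using z t_pos fin12 by (intro mult_left_mono) (auto simp: card_mono)
      finally show ?thesis .
    qed
    moreover have "s V1 H = (\<Sum>x\<in>V1 - X. real (dH x)) + (\<Sum>x\<in>X. real (dH x))"
      unfolding s_def dH_def using fin12 by (intro sum.subset_diff) (auto simp: X_def)
    ultimately show ?thesis by linarith
  qed
  have s22: "s V2 V2 \<le> 9/5 * t * card V2"
    unfolding s_def by (rule sum_inner_degrees_le[where \<theta> = \<theta>]) (use V12 th0 g3 tt Lf Lq in auto)
  \<comment> \<open>Edges between the two classes are counted from \<open>V1\<close>, whose vertices
    send few edges into \<open>L\<close>.\<close>
  have s21: "s V2 V1 \<le> m V1"
  proof -
    have "s V2 V1 = s V1 V2" using swap V12 by simp
    also have "\<dots> \<le> s V1 L" using sUn[of V1 V2 V1] V12 s0[of V1 V1] by simp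
    finally show ?thesis using s1L by simp
  qed
  have LL: "s L L \<le> 2 * m V1 + 9/5 * t * card V2"
  proof -
    have "s L L = s V1 L + s V2 L" using sUn1[of V1 V2 L] V12 by simp
    also have "s V2 L = s V2 V1 + s V2 V2" using sUn[of V1 V2 V2] V12 by simp
    finally show ?thesis using s1L s21 s22 by linarith
  qed
  have LH: "s L H \<le> (1 - \<zeta>) * t * card V1 + \<theta> * (t * n) + m V2"
    using sUn1[of V1 V2 H] V12 s1H s2H by simp
  have "s H V = s H H + s R H + s L H" using sV[of H] swap sub by simp
  moreover have "s L V = s L H + s R L + s L L" using sV[of L] swap sub by simp
  moreover have "s R H + s R L \<le> nR" using sV[of R] nR' s0[of R R] by linarith
  \<comment> \<open>Edges between \<open>L\<close> and \<open>H\<close> occur in both directions.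
    Those between \<open>R\<close> and the other classes are absorbed by a second copy of
    \<open>nR\<close>.\<close>
  ultimately have "s V V \<le> s H H + 2 * nR + 2 * s L H + s L L" using VV nR' by linarith
  \<comment> \<open>The nine error terms: one from \<open>H\<close> with itself, two from
    \<open>R\<close>, two from the exceptional part of \<open>s V1 H\<close>, and four from
    \<open>2 * m L\<close>.\<close>
  also have "\<dots> \<le> 9 * (\<theta> * (t * n)) + 2 * ((1 - \<zeta>) * t * card V1) + 9/5 * t * card V2"
  proof -
    define T a1 a2 where "T = \<theta> * (t * n)" and "a1 = (1 - \<zeta>) * t * card V1" and "a2 = 9/5 * t * card V2"
    note [folded T_def a1_def a2_def] = HH nR LH LL mL
    thus ?thesis unfolding T_def[symmetric] a1_def[symmetric] a2_def[symmetric] using mL' by linarith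
  qed
  also have "9/5 * t * card V2 \<le> 2 * ((1 - \<zeta>) * t * card V2)"
  proof -
    have "9/5 * (t * card V2) \<le> (2 * (1 - \<zeta>)) * (t * card V2)"
      using z t_pos by (intro mult_right_mono) auto
    thus ?thesis by (simp only: mult.assoc)
  qed
  also have "9 * (\<theta> * (t * n)) + 2 * ((1 - \<zeta>) * t * card V1) + 2 * ((1 - \<zeta>) * t * card V2)
     = 9 * (\<theta> * (t * n)) + 2 * ((1 - \<zeta>) * t) * card L"
  proof -
    have "card L = card V1 + card V2"
      using card_Un_disjoint[OF fin12 V12(2)] by (simp add: V12(1))
    thus ?thesis by (simp add: algebra_simps)
  qed
  also have "2 * ((1 - \<zeta>) * t) * card L \<le> 2 * ((1 - \<zeta>) * t) * n"
    using card_mono[OF finV sub(3)] z t_pos by (intro mult_left_mono) (auto simp: n_def)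
  also have "9 * (\<theta> * (t * n)) + 2 * ((1 - \<zeta>) * t) * n = (2 - 2 * \<zeta> + 9 * \<theta>) * (t * n)"
    by (simp add: algebra_simps)
  \<comment> \<open>The choice \<open>\<theta> = \<zeta> / 40\<close> keeps
    \<open>9 * \<theta>\<close> below \<open>\<zeta>\<close>.\<close>
  also have "\<dots> \<le> (2 - \<zeta>) * (t * n)" using tn0 th z by (intro mult_right_mono) auto
  finally show ?thesis by (simp add: s_def n_def mult.assoc)
qed

end

section \<open>Maximal balanced families\<close>

lemma double_count_le:
  assumes fin: "finite H" "finite \<T>"
    and lower: "\<And>T. T \<in> \<T> \<Longrightarrow> c \<le> real (card {h \<in> H. R h T})"
    and upper: "\<And>h. h \<in> H \<Longrightarrow> card {T \<in> \<T>. R h T} \<le> k"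
  shows "c * real (card \<T>) \<le> real k * real (card H)"
proof -
  have "c * real (card \<T>) \<le> (\<Sum>T\<in>\<T>. real (card {h \<in> H. R h T}))"
    using sum_mono[of \<T> "\<lambda>_. c", OF lower] by (simp add: mult.commute)
  also have "\<dots> = (\<Sum>T\<in>\<T>. \<Sum>h\<in>H. of_bool (R h T))"
    using fin by (intro sum.cong) (auto simp: of_bool_def sum.If_cases Int_def)
  also have "\<dots> = (\<Sum>h\<in>H. \<Sum>T\<in>\<T>. of_bool (R h T))" by (rule sum.swap)
  also have "\<dots> = (\<Sum>h\<in>H. real (card {T \<in> \<T>. R h T}))"
    using fin by (intro sum.cong) (auto simp: of_bool_def sum.If_cases Int_def)
  also have "\<dots> \<le> (\<Sum>h\<in>H. real k)" by (intro sum_mono) (use upper in simp)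
  finally show ?thesis by (simp add: mult.commute)
qed

lemma max_hdeg_le:
  assumes "finite M" "r \<ge> 0"
    and "\<And>T0 T1. T0 \<subseteq> M \<Longrightarrow> T1 \<subseteq> M \<Longrightarrow> card T0 = l0 \<Longrightarrow> card T1 = l1 \<Longrightarrow> real (hdeg H T0 T1) \<le> r"
  shows "real (max_hdeg M l0 l1 H) \<le> r"
proof -
  let ?S = "{hdeg H T0 T1 | T0 T1. T0 \<subseteq> M \<and> T1 \<subseteq> M \<and> T0 \<inter> T1 = {} \<and> finite T0 \<and> finite T1 \<and>
       card T0 = l0 \<and> card T1 = l1}"
  have "?S \<subseteq> (\<lambda>(T0, T1). hdeg H T0 T1) ` (Pow M \<times> Pow M)" by force
  hence "finite ?S" using assms(1) by (meson finite_Pow_iff finite_SigmaI finite_imageI finite_subset)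
  hence "max_hdeg M l0 l1 H \<in> insert 0 ?S" unfolding max_hdeg_def by (intro Max_in) auto
  thus ?thesis using assms(2,3) by auto
qed

text \<open>The degree conditions of the theorem without the maxima, so that they can be checked set
  by set when one pair is added to \<open>H\<close>.\<close>

definition balanced :: "'a set set \<Rightarrow> nat \<Rightarrow> nat \<Rightarrow> nat \<Rightarrow> ('a set set \<times> 'a set set) set \<Rightarrow> bool" where
  "balanced M n l i H \<longleftrightarrow>
     (\<forall>e\<in>M. real (hdeg H {} {e}) \<le> real l ^ 3 / real n) \<and>
     (\<forall>T\<subseteq>M. card T = 2 \<longrightarrow> hdeg H {} T \<le> l) \<and>
     (i > 0 \<longrightarrow> (\<forall>e\<in>M. hdeg H {e} {} \<le> l\<^sup>2))"

lemma balanced_max_hdeg: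
  assumes M: "finite M" and b: "balanced M n l i H"
  shows "real (max_hdeg M 0 1 H) \<le> real l ^ 3 / real n" "max_hdeg M 0 2 H \<le> l"
    "i > 0 \<Longrightarrow> max_hdeg M 1 0 H \<le> l\<^sup>2"
proof -
  have fin: "T = {}" if "T \<subseteq> M" "card T = 0" for T
    using that M finite_subset by fastforce
  show "real (max_hdeg M 0 1 H) \<le> real l ^ 3 / real n"
  proof (rule max_hdeg_le[OF M])
    fix T0 T1 assume "T0 \<subseteq> M" "T1 \<subseteq> M" "card T0 = 0" "card T1 = 1"
    moreover from this obtain e where "T1 = {e}" by (auto simp: card_1_singleton_iff)
    ultimately show "real (hdeg H T0 T1) \<le> real l ^ 3 / real n"
      using b fin by (auto simp: balanced_def)
  qed auto
  have "real (max_hdeg M 0 2 H) \<le> real l"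
  proof (rule max_hdeg_le[OF M])
    fix T0 T1 assume "T0 \<subseteq> M" "T1 \<subseteq> M" "card T0 = 0" "card T1 = 2"
    moreover from this have "T0 = {}" by (intro fin)
    ultimately show "real (hdeg H T0 T1) \<le> real l" using b by (auto simp: balanced_def)
  qed auto
  thus "max_hdeg M 0 2 H \<le> l" by simp
  assume i: "i > 0"
  have "real (max_hdeg M 1 0 H) \<le> real (l\<^sup>2)"
  proof (rule max_hdeg_le[OF M])
    fix T0 T1 assume "T0 \<subseteq> M" "T1 \<subseteq> M" "card T0 = 1" "card T1 = 0"
    moreover from this obtain e where "T0 = {e}" by (auto simp: card_1_singleton_iff)
    moreover have "T1 = {}" using calculation by (intro fin)
    ultimately show "real (hdeg H T0 T1) \<le> real (l\<^sup>2)"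
      using b i unfolding of_nat_le_iff by (auto simp: balanced_def)
  qed auto
  thus "max_hdeg M 1 0 H \<le> l\<^sup>2" by (simp only: of_nat_le_iff)
qed

lemma is_C4_facts:
  assumes "is_C4 S B" shows "\<Union>B = S" "card S = 4" "card B = 4"
proof -
  obtain a b c d where *: "distinct [a, b, c, d]" "S = {a, b, c, d}"
      "B = {{a, b}, {b, c}, {c, d}, {d, a}}"
    using assms by (auto simp: is_C4_def)
  show "\<Union>B = S" using * by auto
  show "card S = 4" using * by simp
  show "card B = 4" using * by (auto simp: doubleton_eq_iff card_insert_if)
qed

text \<open>The cycle \<open>B\<close> determines its vertex set as \<open>\<Union>B\<close>, and
  hence also \<open>A\<close>. So hyperedges can be counted through their second components
  alone.\<close>

lemma C4_hypergraph_facts: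
  assumes "(A, B) \<in> C4_hypergraph M E i" and M: "finite M"
  shows "A = induced M (\<Union>B) - B" "card (\<Union>B) = 4" "card B = 4" "card A = i" "A \<subseteq> M" "B \<subseteq> M"
proof -
  obtain S where S: "is_C4 S B" "B \<subseteq> M" "card (induced M S) = 4 + i" "A = induced M S - B"
    using assms by (auto simp: C4_hypergraph_def good_C4_def)
  note C = is_C4_facts[OF S(1)]
  show "A = induced M (\<Union>B) - B" "card (\<Union>B) = 4" "card B = 4" "A \<subseteq> M" "B \<subseteq> M"
    using S C by (auto simp: induced_def)
  have "B \<subseteq> induced M S" using S C by (auto simp: induced_def)
  moreover have "finite B" using C(3) by (intro card_ge_0_finite) simp
  ultimately show "card A = i" using S C by (simp add: card_Diff_subset)
qed

lemma hdeg_insert_le: "finite H \<Longrightarrow> hdeg (insert h H) T0 T1 \<le> Suc (hdeg H T0 T1)"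
proof -
  assume H: "finite H"
  have "hdeg (insert h H) T0 T1 \<le> card (insert h {(A, B) \<in> H. T0 \<subseteq> A \<and> T1 \<subseteq> B})"
    unfolding hdeg_def
    by (rule card_mono) (use H in \<open>auto intro: finite_subset[OF _ H]\<close>)
  also have "\<dots> \<le> Suc (hdeg H T0 T1)" unfolding hdeg_def by (rule card_insert_le_m1) auto
  finally show ?thesis .
qed

lemma hdeg_insert_eq:
  "\<not> (T0 \<subseteq> A \<and> T1 \<subseteq> B) \<Longrightarrow> hdeg (insert (A, B) H) T0 T1 = hdeg H T0 T1"
  unfolding hdeg_def by (rule arg_cong[where f = card]) auto

text \<open>A 4-cycle containing two disjoint edges is determined up to bounded choice by them, since
  they span its vertex set; so only pairs of edges with a common vertex can have large degree.\<close>

lemma hdeg_disjoint_pair_le: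
  assumes H: "H \<subseteq> C4_hypergraph M E i" and M: "M \<subseteq> [V]\<^bsup>2\<^esup>" "finite M"
    and ef: "e \<in> M" "f \<in> M" "e \<inter> f = {}"
  shows "hdeg H {} {e, f} \<le> 2 ^ 16"
proof -
  have ce: "card e = 2" "card f = 2" "finite e" "finite f" using M ef by (auto simp: nsets_def)
  have c4: "card (e \<union> f) = 4" using ce ef by (simp add: card_Un_disjoint)
  have "{(A, B) \<in> H. {} \<subseteq> A \<and> {e, f} \<subseteq> B} \<subseteq> (\<lambda>B. (induced M (\<Union>B) - B, B)) ` Pow (Pow (e \<union> f))"
  proof
    fix h assume h: "h \<in> {(A, B) \<in> H. {} \<subseteq> A \<and> {e, f} \<subseteq> B}"
    then obtain A B where [simp]: "h = (A, B)" and AB: "(A, B) \<in> H" "{e, f} \<subseteq> B" by auto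
    note F = C4_hypergraph_facts[OF subsetD[OF H AB(1)] M(2)]
    have "e \<union> f = \<Union>B"
    proof (rule card_subset_eq)
      show "finite (\<Union>B)" using F(2) by (intro card_ge_0_finite) simp
      show "e \<union> f \<subseteq> \<Union>B" using AB(2) by auto
      show "card (e \<union> f) = card (\<Union>B)" using F(2) c4 by simp
    qed
    hence "B \<in> Pow (Pow (e \<union> f))" by auto
    thus "h \<in> (\<lambda>B. (induced M (\<Union>B) - B, B)) ` Pow (Pow (e \<union> f))" using F(1) by auto
  qed
  hence "hdeg H {} {e, f} \<le> card ((\<lambda>B. (induced M (\<Union>B) - B, B)) ` Pow (Pow (e \<union> f)))"
    unfolding hdeg_def using ce by (intro card_mono) auto
  also have "\<dots> \<le> card (Pow (Pow (e \<union> f)))" by (rule card_image_le) (use ce in auto)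
  also have "\<dots> = 2 ^ 16" using ce c4 by (simp add: card_Pow)
  finally show ?thesis .
qed

text \<open>Here \<open>B1\<close>, \<open>B2\<close> and \<open>D\<close> contain the cycle edges, the pairs of cycle edges and the diagonals
  whose degree in a maximal balanced \<open>H\<close> admits no further increase.\<close>

definition saturation where
  "saturation M E n l \<beta> i H B1 B2 D \<longleftrightarrow>
    H \<subseteq> C4_hypergraph M E i \<and> finite H \<and> real (card H) < \<beta> * real l ^ 4 \<and>
    B1 \<subseteq> M \<and> real (card B1) \<le> 8 * \<beta> * real l * real n \<and>
    B2 \<subseteq> Pow M \<and> real (card B2) \<le> 16 * \<beta> * real l ^ 3 \<and>
    D \<subseteq> M \<and> real (card D) \<le> 2 * \<beta> * (real l)\<^sup>2 \<and>
    (\<forall>e f. {e, f} \<in> B2 \<longrightarrow> e \<inter> f \<noteq> {}) \<and> (\<forall>T\<in>B2. card T = 2) \<and>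
    (\<forall>(A, B)\<in>C4_hypergraph M E i. B \<inter> B1 = {} \<longrightarrow> A \<inter> D = {} \<longrightarrow>
       (\<forall>T\<in>B2. \<not> T \<subseteq> B) \<longrightarrow> (A, B) \<in> H)"

text \<open>\<open>H\<close> is an inclusion-maximal balanced family. It is small by assumption, so
  double counting allows few saturated edges, pairs and diagonals; a hyperedge avoiding all of them
  could be added, so by maximality it already belongs to \<open>H\<close>.\<close>

lemma saturation_exists:
  assumes M: "M \<subseteq> [V]\<^bsup>2\<^esup>" "finite M" and n: "n \<ge> 1" and l: "l > 2 ^ 16" "real l ^ 3 / real n \<ge> 2"
    and i: "i \<le> 2"
    and small: "\<And>H. H \<subseteq> C4_hypergraph M E i \<Longrightarrow> balanced M n l i H \<Longrightarrow> real (card H) < \<beta> * real l ^ 4"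
  shows "\<exists>H B1 B2 D. saturation M E n l \<beta> i H B1 B2 D"
proof -
  let ?F = "C4_hypergraph M E i"
  have "?F \<subseteq> Pow M \<times> Pow M" using C4_hypergraph_facts[OF _ M(2)] by fast
  hence finF: "finite ?F" using M(2) by (meson finite_Pow_iff finite_SigmaI finite_subset)
  have "balanced M n l i {}" by (simp add: balanced_def hdeg_def)
  hence "{H. H \<subseteq> ?F \<and> balanced M n l i H} \<noteq> {}" by blast
  moreover have "finite {H. H \<subseteq> ?F \<and> balanced M n l i H}" using finF by simp
  ultimately obtain H where H: "H \<subseteq> ?F" "balanced M n l i H"
    and Hmax: "\<And>H'. H' \<subseteq> ?F \<Longrightarrow> balanced M n l i H' \<Longrightarrow> H \<subseteq> H' \<Longrightarrow> H = H'"
    using finite_has_maximal[of "{H. H \<subseteq> ?F \<and> balanced M n l i H}"] by auto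
  have finH: "finite H" using H(1) finF by (rule finite_subset)
  have cH: "real (card H) < \<beta> * real l ^ 4" by (rule small[OF H])
  have l0: "real l > 0" using l by simp
  \<comment> \<open>The summand 1 is there because the bound need not be an integer: saturated means
    that one more hyperedge would exceed it. As the bound is at least 2, a saturated edge still has
    at least half of it as degree.\<close>
  define B1 where "B1 = {e \<in> M. real (hdeg H {} {e}) + 1 > real l ^ 3 / real n}"
  define B2 where "B2 = {T. T \<subseteq> M \<and> card T = 2 \<and> hdeg H {} T \<ge> l}"
  define D where "D = {e \<in> M. hdeg H {e} {} \<ge> l\<^sup>2}"
  have fin: "finite B1" "finite B2" "finite D"
    using M(2) by (auto simp: B1_def B2_def D_def)
  note facts = C4_hypergraph_facts[OF subsetD[OF H(1)] M(2)]
  have finAB: "finite A" "finite B" if "(A, B) \<in> H" for A B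
    using facts(5,6)[OF that] M(2) by (auto intro: finite_subset)
  have c1: "real (card B1) \<le> 8 * \<beta> * real l * real n"
  proof -
    have "real l ^ 3 / real n / 2 * real (card B1) \<le> real 4 * real (card H)"
    proof (rule double_count_le[where R = "\<lambda>h e. e \<in> snd h"])
      fix e assume "e \<in> B1"
      moreover have "{h \<in> H. e \<in> snd h} = {(A, B) \<in> H. {} \<subseteq> A \<and> {e} \<subseteq> B}" by auto
      ultimately show "real l ^ 3 / real n / 2 \<le> real (card {h \<in> H. e \<in> snd h})"
        using l by (simp add: B1_def hdeg_def)
    next
      fix h assume h: "h \<in> H"
      obtain A B where [simp]: "h = (A, B)" by (cases h)
      have "card {T \<in> B1. T \<in> B} \<le> card B" using finAB h by (intro card_mono) auto
      thus "card {T \<in> B1. T \<in> snd h} \<le> 4" using facts h by simp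
    qed (use finH fin in auto)
    hence "real l ^ 3 / real n / 2 * real (card B1) \<le> 4 * (\<beta> * real l ^ 4)" using cH by simp
    hence "real l ^ 3 * real (card B1) \<le> real l ^ 3 * (8 * \<beta> * real l * real n)"
      using n by (simp add: field_simps power4_eq_xxxx power3_eq_cube)
    thus ?thesis using l0 by simp
  qed
  have c2: "real (card B2) \<le> 16 * \<beta> * real l ^ 3"
  proof -
    have "real l * real (card B2) \<le> real 16 * real (card H)"
    proof (rule double_count_le[where R = "\<lambda>h T. T \<subseteq> snd h"])
      fix T assume "T \<in> B2"
      moreover have "{h \<in> H. T \<subseteq> snd h} = {(A, B) \<in> H. {} \<subseteq> A \<and> T \<subseteq> B}" by auto
      ultimately show "real l \<le> real (card {h \<in> H. T \<subseteq> snd h})"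
        by (simp add: B2_def hdeg_def)
    next
      fix h assume h: "h \<in> H"
      obtain A B where [simp]: "h = (A, B)" by (cases h)
      \<comment> \<open>A crude count: all 16 subsets of \<open>B\<close> instead of its six
        pairs.\<close>
      have "card {T \<in> B2. T \<subseteq> B} \<le> card (Pow B)" using finAB h by (intro card_mono) auto
      thus "card {T \<in> B2. T \<subseteq> snd h} \<le> 16" using facts h finAB by (simp add: card_Pow)
    qed (use finH fin in auto)
    hence "real l * real (card B2) \<le> 16 * (\<beta> * real l ^ 4)" using cH by simp
    also have "\<dots> = real l * (16 * \<beta> * real l ^ 3)" by (simp add: power4_eq_xxxx power3_eq_cube)
    finally have "real l * real (card B2) \<le> real l * (16 * \<beta> * real l ^ 3)" .
    thus ?thesis using l0 by simp
  qed
  have c3: "real (card D) \<le> 2 * \<beta> * (real l)\<^sup>2"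
  proof -
    have "(real l)\<^sup>2 * real (card D) \<le> real 2 * real (card H)"
    proof (rule double_count_le[where R = "\<lambda>h e. e \<in> fst h"])
      fix e assume "e \<in> D"
      moreover have "{h \<in> H. e \<in> fst h} = {(A, B) \<in> H. {e} \<subseteq> A \<and> {} \<subseteq> B}" by auto
      ultimately have "l\<^sup>2 \<le> card {h \<in> H. e \<in> fst h}"
        by (simp add: D_def hdeg_def)
      hence "real (l\<^sup>2) \<le> real (card {h \<in> H. e \<in> fst h})" by (simp only: of_nat_le_iff)
      thus "(real l)\<^sup>2 \<le> real (card {h \<in> H. e \<in> fst h})" by simp
    next
      fix h assume h: "h \<in> H"
      obtain A B where [simp]: "h = (A, B)" by (cases h)
      have "card {T \<in> D. T \<in> A} \<le> card A" using finAB h by (intro card_mono) auto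
      thus "card {T \<in> D. T \<in> fst h} \<le> 2" using facts h i by simp
    qed (use finH fin in auto)
    hence "(real l)\<^sup>2 * real (card D) \<le> 2 * (\<beta> * real l ^ 4)" using cH by simp
    also have "\<dots> = (real l)\<^sup>2 * (2 * \<beta> * (real l)\<^sup>2)" by (simp add: power4_eq_xxxx power2_eq_square)
    finally have "(real l)\<^sup>2 * real (card D) \<le> (real l)\<^sup>2 * (2 * \<beta> * (real l)\<^sup>2)" .
    thus ?thesis using l0 by simp
  qed
  have disj: "e \<inter> f \<noteq> {}" if "{e, f} \<in> B2" for e f
  proof
    assume "e \<inter> f = {}"
    hence "hdeg H {} {e, f} \<le> 2 ^ 16"
      using that by (intro hdeg_disjoint_pair_le[OF H(1) M]) (auto simp: B2_def)
    moreover have "l \<le> hdeg H {} {e, f}" using that by (auto simp: B2_def)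
    ultimately show False using l(1) by linarith
  qed
  have max: "(A, B) \<in> H" if AB: "(A, B) \<in> ?F" and b1: "B \<inter> B1 = {}" and d: "A \<inter> D = {}"
    and b2: "\<And>T. T \<in> B2 \<Longrightarrow> \<not> T \<subseteq> B" for A B
  proof -
    let ?H = "insert (A, B) H"
    \<comment> \<open>Adding \<open>(A, B)\<close> raises only the degrees of elements of
      \<open>A\<close> and of elements and pairs of \<open>B\<close>, none of which is
      saturated.\<close>
    have "balanced M n l i ?H"
      unfolding balanced_def
    proof (intro conjI ballI allI impI)
      fix e assume e: "e \<in> M"
      show "real (hdeg ?H {} {e}) \<le> real l ^ 3 / real n"
      proof (cases "e \<in> B")
        case True
        hence "real (hdeg H {} {e}) + 1 \<le> real l ^ 3 / real n" using b1 e by (auto simp: B1_def not_less)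
        thus ?thesis using hdeg_insert_le[OF finH, of "(A, B)" "{}" "{e}"] by linarith
      next
        case False
        thus ?thesis using H(2) e by (simp add: hdeg_insert_eq balanced_def)
      qed
    next
      fix T assume T: "T \<subseteq> M" "card T = 2"
      show "hdeg ?H {} T \<le> l"
      proof (cases "T \<subseteq> B")
        case True
        hence "T \<notin> B2" using b2 by blast
        hence "hdeg H {} T < l" using T by (simp add: B2_def)
        thus ?thesis using hdeg_insert_le[OF finH, of "(A, B)" "{}" T] by linarith
      next
        case False
        thus ?thesis using H(2) T by (simp add: hdeg_insert_eq balanced_def)
      qed
    next
      fix e assume i0: "0 < i" and e: "e \<in> M"
      show "hdeg ?H {e} {} \<le> l\<^sup>2"
      proof (cases "e \<in> A")
        case True
        hence "hdeg H {e} {} < l\<^sup>2" using d e by (auto simp: D_def not_le)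
        thus ?thesis using hdeg_insert_le[OF finH, of "(A, B)" "{e}" "{}"] by linarith
      next
        case False
        thus ?thesis using H(2) e i0 by (simp add: hdeg_insert_eq balanced_def)
      qed
    qed
    hence "H = ?H" using Hmax[of ?H] AB H(1) by auto
    thus ?thesis by blast
  qed
  have "saturation M E n l \<beta> i H B1 B2 D"
    unfolding saturation_def using H(1) finH cH c1 c2 c3 disj
    by (auto simp: B1_def[symmetric] B2_def[symmetric] D_def[symmetric] intro!: max)
      (auto simp: B1_def B2_def D_def)
  thus ?thesis by blast
qed

lemma card_UN_le_const:
  assumes "finite I" "\<And>i. i \<in> I \<Longrightarrow> real (card (f i)) \<le> k"
  shows "real (card (\<Union>i\<in>I. f i)) \<le> real (card I) * k"
proof -
  have "real (card (\<Union>i\<in>I. f i)) \<le> real (\<Sum>i\<in>I. card (f i))"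
    unfolding of_nat_le_iff by (rule card_UN_le[OF assms(1)])
  also have "\<dots> \<le> (\<Sum>i\<in>I. k)" unfolding of_nat_sum by (intro sum_mono assms(2))
  finally show ?thesis by simp
qed

text \<open>Merges the three indices \<open>i\<close> and passes from hyperedges to ordered tuples
  of vertices. Saturated cycle edges leave \<open>M\<close>, and saturated diagonals join
  \<open>E\<close>. The latter may remain in \<open>M'\<close>, so \<open>M'\<close> and
  \<open>E'\<close> can overlap. The constants contain a factor 3 for the indices, and 4 ^ 3 or 4 ^
  4 for the tuples in a set of at most four vertices.\<close>

lemma few_C4_outside_saturated:
  assumes pre: "pregraph n M E" and n: "n \<ge> 1" and l: "l > 2 ^ 16" "real l ^ 3 / real n \<ge> 2"
    and small: "\<And>i H. i \<le> 2 \<Longrightarrow> H \<subseteq> C4_hypergraph M E i \<Longrightarrow> balanced M n l i H \<Longrightarrow>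
       real (card H) < \<beta> * real l ^ 4"
  obtains M' E' Q J where
    "M' \<subseteq> M" "real (card (M - M')) \<le> 24 * \<beta> * real l * real n"
    "E \<subseteq> E'" "E' \<subseteq> [{..<n}]\<^bsup>2\<^esup>" "real (card (E' - E)) \<le> 6 * \<beta> * (real l)\<^sup>2"
    "finite Q" "real (card Q) \<le> 3072 * \<beta> * real l ^ 3"
    "finite J" "real (card J) \<le> 768 * \<beta> * real l ^ 4"
    "\<And>x y x' y'. \<lbrakk>x \<noteq> x'; y \<noteq> y'; {x, y} \<in> M'; {y, x'} \<in> M'; {x', y'} \<in> M'; {y', x} \<in> M';
      {x, x'} \<notin> E'; {y, y'} \<notin> E';
      (y, x, y') \<notin> Q; (y, x', y') \<notin> Q; (x, y, x') \<notin> Q; (x, y', x') \<notin> Q\<rbrakk>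
      \<Longrightarrow> (x, y, x', y') \<in> J"
proof -
  have M: "M \<subseteq> [{..<n}]\<^bsup>2\<^esup>" and E: "E \<subseteq> [{..<n}]\<^bsup>2\<^esup>" and ME: "M \<inter> E = {}"
    using pre by (auto simp: pregraph_def)
  have finM: "finite M" using M by (rule finite_subset) (simp add: finite_imp_finite_nsets)
  have M2: "card e = 2" "finite e" if "e \<in> M" for e using M that by (auto simp: nsets_def)
  define p where "p i = (SOME (H, B1, B2, D). saturation M E n l \<beta> i H B1 B2 D)" for i
  define H B1 B2 D where "H i = fst (p i)" and "B1 i = fst (snd (p i))"
    and "B2 i = fst (snd (snd (p i)))" and "D i = snd (snd (snd (p i)))" for i
  have sat: "saturation M E n l \<beta> i (H i) (B1 i) (B2 i) (D i)" if i: "i \<le> 2" for i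
  proof -
    have "\<exists>h b1 b2 d. saturation M E n l \<beta> i h b1 b2 d"
      by (rule saturation_exists[OF M finM n l i]) (rule small[OF i])
    then obtain h b1 b2 d where "saturation M E n l \<beta> i h b1 b2 d" by blast
    hence "case p i of (H, B1, B2, D) \<Rightarrow> saturation M E n l \<beta> i H B1 B2 D"
      unfolding p_def
      by - (rule someI[where P = "\<lambda>(H, B1, B2, D). saturation M E n l \<beta> i H B1 B2 D"
          and x = "(h, b1, b2, d)"], simp)
    thus ?thesis by (simp add: H_def B1_def B2_def D_def case_prod_beta)
  qed
  have sH: "H i \<subseteq> C4_hypergraph M E i" "finite (H i)" "real (card (H i)) \<le> \<beta> * real l ^ 4"
    and sB1: "B1 i \<subseteq> M" "real (card (B1 i)) \<le> 8 * \<beta> * real l * real n"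
    and sB2: "B2 i \<subseteq> Pow M" "real (card (B2 i)) \<le> 16 * \<beta> * real l ^ 3"
      "\<And>e f. {e, f} \<in> B2 i \<Longrightarrow> e \<inter> f \<noteq> {}" "\<And>T. T \<in> B2 i \<Longrightarrow> card T = 2"
    and sD: "D i \<subseteq> M" "real (card (D i)) \<le> 2 * \<beta> * (real l)\<^sup>2"
    and smax: "\<And>A B. (A, B) \<in> C4_hypergraph M E i \<Longrightarrow> B \<inter> B1 i = {} \<Longrightarrow> A \<inter> D i = {} \<Longrightarrow>
       (\<And>T. T \<in> B2 i \<Longrightarrow> \<not> T \<subseteq> B) \<Longrightarrow> (A, B) \<in> H i" if "i \<le> 2" for i
    using sat[OF that] by (auto simp: saturation_def)
  define M' where "M' = M - (\<Union>i\<in>{..2}. B1 i)"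
  define E' where "E' = E \<union> (\<Union>i\<in>{..2}. D i)"
  define BB where "BB = (\<Union>i\<in>{..2}. B2 i)"
  define HH where "HH = (\<Union>i\<in>{..2}. H i)"
  define Q where "Q = {(u, v, w). {{u, v}, {v, w}} \<in> BB}"
  define J where "J = {(x, y, x', y'). \<exists>A. (A, {{x, y}, {y, x'}, {x', y'}, {y', x}}) \<in> HH}"
  have "real (card (\<Union>i\<in>{..2::nat}. B1 i)) \<le> real (card {..2::nat}) * (8 * \<beta> * real l * real n)"
    by (rule card_UN_le_const) (use sB1 in auto)
  moreover have "M - M' = (\<Union>i\<in>{..2}. B1 i)" using sB1(1) unfolding M'_def by fastforce
  ultimately have cM: "real (card (M - M')) \<le> 24 * \<beta> * real l * real n" by simp
  have DM: "(\<Union>i\<in>{..2}. D i) \<subseteq> M" using sD(1) by fastforce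
  have "real (card (\<Union>i\<in>{..2::nat}. D i)) \<le> real (card {..2::nat}) * (2 * \<beta> * (real l)\<^sup>2)"
    by (rule card_UN_le_const) (use sD in auto)
  moreover have "card (E' - E) \<le> card (\<Union>i\<in>{..2::nat}. D i)"
    by (rule card_mono[OF finite_subset[OF DM finM]]) (auto simp: E'_def)
  ultimately have cE: "real (card (E' - E)) \<le> 6 * \<beta> * (real l)\<^sup>2" by simp
  have BBM: "BB \<subseteq> Pow M" using sB2(1) unfolding BB_def by fastforce
  have finBB: "finite BB" using BBM finM by (meson finite_Pow_iff finite_subset)
  have cBB: "real (card BB) \<le> 48 * \<beta> * real l ^ 3"
    using card_UN_le_const[of "{..2}" B2 "16 * \<beta> * real l ^ 3"] sB2(2) by (simp add: BB_def)
  have uT: "finite (\<Union>T)" "card (\<Union>T) \<le> 4" if "T \<in> BB" for T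
  proof -
    have "card T = 2" "T \<subseteq> M" using that sB2(4) BBM by (auto simp: BB_def)
    then obtain e f where T: "T = {e, f}" "e \<in> M" "f \<in> M" by (auto simp: card_2_iff)
    have "\<Union>T = e \<union> f" using T(1) by simp
    thus "finite (\<Union>T)" "card (\<Union>T) \<le> 4"
      using card_Un_le[of e f] M2[OF T(2)] M2[OF T(3)] by simp_all
  qed
  define QT where "QT T = \<Union>T \<times> \<Union>T \<times> \<Union>T" for T :: "nat set set"
  have QQ: "Q \<subseteq> (\<Union>T\<in>BB. QT T)" 
  proof
    fix u assume "u \<in> Q"
    then obtain a b c where "u = (a, b, c)" "{{a, b}, {b, c}} \<in> BB" by (auto simp: Q_def)
    thus "u \<in> (\<Union>T\<in>BB. QT T)" by - (rule UN_I[of "{{a, b}, {b, c}}"], auto simp: QT_def)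
  qed
  have "finite (QT T)" if "T \<in> BB" for T
    unfolding QT_def by (intro finite_cartesian_product uT(1) that)
  hence finQT: "finite (\<Union>T\<in>BB. QT T)" by (rule finite_UN_I[OF finBB])
  have "real (card (QT T)) \<le> 64" if "T \<in> BB" for T
  proof -
    have "card (QT T) \<le> 4 * (4 * 4)" unfolding QT_def card_cartesian_product
      using uT(2)[OF that] by (intro mult_le_mono) auto
    thus ?thesis by simp
  qed
  hence "real (card (\<Union>T\<in>BB. QT T)) \<le> real (card BB) * 64"
    by (rule card_UN_le_const[OF finBB])
  moreover have "card Q \<le> card (\<Union>T\<in>BB. QT T)" by (rule card_mono[OF finQT QQ])
  ultimately have cQ: "real (card Q) \<le> 3072 * \<beta> * real l ^ 3" using cBB by simp
  have finHH: "finite HH" using sH(2) by (auto simp: HH_def)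
  have cHH: "real (card HH) \<le> 3 * (\<beta> * real l ^ 4)"
  proof -
    have "real (card (\<Union>i\<in>{..2::nat}. H i)) \<le> real (card {..2::nat}) * (\<beta> * real l ^ 4)"
      by (rule card_UN_le_const) (use sH(3) in auto)
    thus ?thesis by (simp add: HH_def)
  qed
  have uH: "card (\<Union>(snd h)) = 4" if "h \<in> HH" for h
  proof -
    obtain i where "i \<le> 2" "h \<in> H i" using \<open>h \<in> HH\<close> by (auto simp: HH_def)
    hence "h \<in> C4_hypergraph M E i" using sH(1)[of i] by auto
    thus ?thesis using C4_hypergraph_facts(2)[of "fst h" "snd h" M E i] finM by simp
  qed
  have uHf: "finite (\<Union>(snd h))" if "h \<in> HH" for h
    using uH[OF that] by (intro card_ge_0_finite) simp
  define JT where "JT h = \<Union>(snd h) \<times> \<Union>(snd h) \<times> \<Union>(snd h) \<times> \<Union>(snd h)"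
    for h :: "nat set set \<times> nat set set"
  have JJ: "J \<subseteq> (\<Union>h\<in>HH. JT h)"
  proof
    fix u assume "u \<in> J"
    then obtain x y x' y' A where u: "u = (x, y, x', y')"
      and h: "(A, {{x, y}, {y, x'}, {x', y'}, {y', x}}) \<in> HH"
      by (auto simp: J_def)
    have "u \<in> JT (A, {{x, y}, {y, x'}, {x', y'}, {y', x}})" unfolding u JT_def snd_conv by blast
    with h show "u \<in> (\<Union>h\<in>HH. JT h)" by (rule UN_I)
  qed
  have "finite (JT h)" if "h \<in> HH" for h
    unfolding JT_def by (intro finite_cartesian_product uHf that)
  hence finJT: "finite (\<Union>h\<in>HH. JT h)" by (rule finite_UN_I[OF finHH])
  have "real (card (\<Union>h\<in>HH. JT h)) \<le> real (card HH) * 256"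
    by (rule card_UN_le_const[OF finHH]) (simp add: JT_def card_cartesian_product uH)
  moreover have "card J \<le> card (\<Union>h\<in>HH. JT h)" by (rule card_mono[OF finJT JJ])
  ultimately have cJ: "real (card J) \<le> 768 * \<beta> * real l ^ 4" using cHH by simp
  have E'sub: "E' \<subseteq> [{..<n}]\<^bsup>2\<^esup>" using E DM M by (auto simp: E'_def)
  have main: "(x, y, x', y') \<in> J"
    if d: "x \<noteq> x'" "y \<noteq> y'" and m: "{x, y} \<in> M'" "{y, x'} \<in> M'" "{x', y'} \<in> M'" "{y', x} \<in> M'"
      and e: "{x, x'} \<notin> E'" "{y, y'} \<notin> E'"
      and q: "(y, x, y') \<notin> Q" "(y, x', y') \<notin> Q" "(x, y, x') \<notin> Q" "(x, y', x') \<notin> Q" for x y x' y'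
  proof -
    define S where "S = {x, y, x', y'}"
    define B where "B = {{x, y}, {y, x'}, {x', y'}, {y', x}}"
    define A where "A = induced M S - B"
    have mM: "{x, y} \<in> M" "{y, x'} \<in> M" "{x', y'} \<in> M" "{y', x} \<in> M"
      using m by (auto simp: M'_def)
    have ne: "x \<noteq> y" "y \<noteq> x'" "x' \<noteq> y'" "y' \<noteq> x" using mM[THEN M2(1)] by auto
    have "distinct [x, y, x', y']" using ne d by auto
    hence C4: "is_C4 S B" unfolding is_C4_def S_def B_def by blast
    have BM: "B \<subseteq> M" using mM by (auto simp: B_def)
    \<comment> \<open>Apart from the cycle edges, four vertices span only the two diagonals. Hence
      \<open>card A \<le> 2\<close>, and the index of the cycle is 0, 1 or 2.\<close>
    have pairs: "p \<in> B \<or> p = {x, x'} \<or> p = {y, y'}" if pn: "p \<in> [{..<n}]\<^bsup>2\<^esup>" and pS: "p \<subseteq> S" for p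
    proof -
      obtain u v where p: "p = {u, v}" "u \<noteq> v" using pn by (auto elim: nsets2_E)
      have "u \<in> {x, y, x', y'}" "v \<in> {x, y, x', y'}" using p pS by (auto simp: S_def)
      thus ?thesis unfolding B_def p(1)
        by (elim insertE emptyE) (use p(2) in \<open>simp_all add: doubleton_eq_iff\<close>)
    qed
    have A2: "A \<subseteq> {{x, x'}, {y, y'}}" using pairs M by (auto simp: A_def induced_def)
    have "card A \<le> card {{x, x'}, {y, y'}}" by (rule card_mono[OF _ A2]) simp
    also have "\<dots> \<le> 2" by (simp add: card_insert_if)
    finally have i2: "card A \<le> 2" .
    have "p \<notin> E" if "p \<subseteq> S" for p
    proof
      assume pE: "p \<in> E"
      hence "p \<in> B \<or> p = {x, x'} \<or> p = {y, y'}" using pairs E that by auto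
      thus False using pE e BM ME by (auto simp: E'_def)
    qed
    hence good: "good_C4 M E S B" using C4 BM by (auto simp: good_C4_def induced_def)
    have "B \<subseteq> induced M S" using BM by (auto simp: induced_def B_def S_def)
    hence "induced M S = B \<union> A" by (auto simp: A_def)
    moreover have "finite A" "finite B" using A2 BM finM by (auto intro: finite_subset)
    ultimately have "card (induced M S) = card B + card A"
      using card_Un_disjoint[of B A] by (auto simp: A_def)
    hence "card (induced M S) = 4 + card A" using is_C4_facts(3)[OF C4] by simp
    hence F: "(A, B) \<in> C4_hypergraph M E (card A)" using good by (auto simp: C4_hypergraph_def A_def)
    have "B \<inter> B1 (card A) = {}" using m i2 by (auto simp: B_def M'_def)
    moreover have "A \<inter> D (card A) = {}" using A2 e i2 by (auto simp: E'_def)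
    \<comment> \<open>A saturated pair consists of intersecting edges, while opposite edges of the
      cycle are disjoint. So it would consist of consecutive edges, and those four pairs are
      excluded by the assumptions on \<open>Q\<close>.\<close>
    moreover have "\<not> T \<subseteq> B" if T: "T \<in> B2 (card A)" for T
    proof
      assume TB: "T \<subseteq> B"
      have TBB: "T \<in> BB" using T i2 by (auto simp: BB_def)
      have "card T = 2" using sB2(4) i2 T by blast
      then obtain f g where fg: "T = {f, g}" "f \<noteq> g" by (auto simp: card_2_iff)
      have fgi: "f \<inter> g \<noteq> {}" using sB2(3)[OF i2] T fg by blast
      define e1 e2 e3 e4 where e: "e1 = {x, y}" "e2 = {y, x'}" "e3 = {x', y'}" "e4 = {y', x}"
      have nQ: "{e1, e2} \<notin> BB" "{e2, e3} \<notin> BB" "{e3, e4} \<notin> BB" "{e4, e1} \<notin> BB"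
        using q unfolding Q_def e by (simp_all add: insert_commute)
      have disj: "e1 \<inter> e3 = {}" "e2 \<inter> e4 = {}" using ne d unfolding e by auto
      have "f \<in> {e1, e2, e3, e4}" "g \<in> {e1, e2, e3, e4}" using TB fg unfolding B_def e by auto
      moreover have "{f, g} \<in> BB" using TBB fg by simp
      ultimately show False using fg(2) fgi nQ disj
        by (elim insertE emptyE) (simp_all add: insert_commute Int_commute)
    qed
    ultimately have "(A, B) \<in> H (card A)" using smax[OF i2 F] by blast
    hence "(A, B) \<in> HH" using i2 by (auto simp: HH_def)
    thus ?thesis by (auto simp: J_def B_def)
  qed
  show ?thesis
    by (rule that[of M' E' Q J])
      (use cM cE cQ cJ E'sub finite_subset[OF QQ finQT] finite_subset[OF JJ finJT] main in
        \<open>auto simp: M'_def E'_def\<close>)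
qed

section \<open>Edge counts inside vertex sets, and distance from a complete graph\<close>

lemma card_ordered_pairs:
  assumes F: "F \<subseteq> [V]\<^bsup>2\<^esup>" "finite F"
  shows "card {(x, y) \<in> W \<times> W. {x, y} \<in> F} = 2 * card (induced F W)"
proof -
  have "{(x, y) \<in> W \<times> W. {x, y} \<in> F} = (\<Union>e\<in>induced F W. {(x, y). {x, y} = e})"
    by (auto simp: induced_def)
  also have "card \<dots> = (\<Sum>e\<in>induced F W. card {(x, y). {x, y} = e})"
  proof (rule card_UN_disjoint)
    show "finite (induced F W)" using F by (simp add: induced_def)
    show "\<forall>e\<in>induced F W. finite {(x, y). {x, y} = e}"
    proof
      fix e assume "e \<in> induced F W"
      hence "finite e" using F by (auto simp: induced_def nsets_def)
      thus "finite {(x, y). {x, y} = e}" by - (rule finite_subset[of _ "e \<times> e"], auto)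
    qed
  qed auto
  also have "\<dots> = (\<Sum>e\<in>induced F W. 2)"
  proof (rule sum.cong[OF refl])
    fix e assume "e \<in> induced F W"
    then obtain a b where e: "e = {a, b}" "a \<noteq> b"
      using F by (auto simp: induced_def elim!: nsets2_E dest!: subsetD)
    hence "{(x, y). {x, y} = e} = {(a, b), (b, a)}" by (auto simp: doubleton_eq_iff)
    thus "card {(x, y). {x, y} = e} = 2" using e by simp
  qed
  finally show ?thesis by simp
qed

text \<open>If \<open>E\<close> were dense on \<open>N\<close>, then growing or shrinking
  \<open>N\<close> to a set \<open>W\<close> of exactly \<open>l\<close> vertices would lose few
  edges. As \<open>card E \<le> l choose 2\<close>, a large \<open>induced E W\<close> leaves both
  few edges outside \<open>W\<close> and few missing pairs inside, so \<open>E\<close> would be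
  close to complete on \<open>W\<close>.\<close>

lemma card_induced_le_of_not_close:
  fixes \<epsilon> \<zeta> :: real
  assumes E: "E \<subseteq> [{..<n}]\<^bsup>2\<^esup>" "card E \<le> l choose 2" and far: "\<not> close_to_complete n E \<epsilon> l"
    and l: "l \<le> n" "l \<ge> 2" and z: "0 < \<zeta>" "\<zeta> \<le> 1" "48 * \<zeta> \<le> \<epsilon>"
    and N: "N \<subseteq> {..<n}" "(1 - \<zeta>) * l \<le> card N" "card N \<le> (1 + \<zeta>) * l"
  shows "2 * real (card (induced E N)) \<le> (1 - 8 * \<zeta>) * (real l)\<^sup>2"
proof (rule ccontr)
  assume big: "\<not> ?thesis"
  have finN: "finite N" using N(1) finite_subset by blast
  have finE: "finite E" using E(1) by (rule finite_subset) (simp add: finite_imp_finite_nsets)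
  have "\<exists>W\<subseteq>{..<n}. card W = l \<and> card (induced E N) \<le> card (induced E W) + 2 * \<zeta> * (real l)\<^sup>2"
  proof (cases "card N \<le> l")
    case True
    obtain W where W: "N \<subseteq> W" "W \<subseteq> {..<n}" "card W = l"
      using exists_subset_between[OF True _ N(1)] l by auto
    have "card (induced E N) \<le> card (induced E W)"
      using W finE by (intro card_mono) (auto simp: induced_def)
    moreover have "0 \<le> 2 * \<zeta> * (real l)\<^sup>2" using z by simp
    ultimately have "card (induced E N) \<le> card (induced E W) + 2 * \<zeta> * (real l)\<^sup>2" by linarith
    thus ?thesis using W by blast
  next
    case False
    then obtain W where W: "W \<subseteq> N" "card W = l"
      using obtain_subset_with_card_n[of l N] by (metis nat_le_linear)
    \<comment> \<open>The edges lost in shrinking meet \<open>N - W\<close>; there are at most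
      \<open>\<zeta> * l\<close> such vertices, each with at most \<open>2 * l\<close>
      partners.\<close>
    have "induced E N \<subseteq> induced E W \<union> (\<lambda>(x, y). {x, y}) ` ((N - W) \<times> N)"
    proof
      fix p assume p: "p \<in> induced E N"
      then obtain x y where xy: "p = {x, y}"
        using E(1) by (auto simp: induced_def elim!: nsets2_E dest!: subsetD)
      show "p \<in> induced E W \<union> (\<lambda>(x, y). {x, y}) ` ((N - W) \<times> N)"
      proof (cases "x \<in> W \<and> y \<in> W")
        case True
        thus ?thesis using p xy by (auto simp: induced_def)
      next
        case False
        hence "(x, y) \<in> (N - W) \<times> N \<or> (y, x) \<in> (N - W) \<times> N" using p xy by (auto simp: induced_def)
        thus ?thesis unfolding xy by (force simp: insert_commute)
      qed
    qed
    hence "card (induced E N) \<le> card (induced E W \<union> (\<lambda>(x, y). {x, y}) ` ((N - W) \<times> N))"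
      using finN finE by (intro card_mono) (auto simp: induced_def)
    also have "\<dots> \<le> card (induced E W) + card ((\<lambda>(x, y). {x, y}) ` ((N - W) \<times> N))" by (rule card_Un_le)
    also have "card ((\<lambda>(x, y). {x, y}) ` ((N - W) \<times> N)) \<le> card ((N - W) \<times> N)"
      using finN by (intro card_image_le) auto
    also have "\<dots> = (card N - l) * card N"
      using W finN by (simp add: card_cartesian_product card_Diff_subset finite_subset)
    finally have "card (induced E N) \<le> card (induced E W) + (card N - l) * card N" by simp
    hence "real (card (induced E N)) \<le> real (card (induced E W) + (card N - l) * card N)"
      by (simp only: of_nat_le_iff)
    also have "\<dots> = card (induced E W) + (real (card N) - real l) * real (card N)"
      using False by (simp add: of_nat_diff)
    also have "(real (card N) - real l) * real (card N) \<le> (\<zeta> * real l) * (2 * real l)"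
    proof (rule mult_mono)
      show "real (card N) - real l \<le> \<zeta> * real l" using N(3) distrib_right[of 1 \<zeta> "real l"] by linarith
      have "(1 + \<zeta>) * real l \<le> 2 * real l" using z by (intro mult_right_mono) auto
      thus "real (card N) \<le> 2 * real l" using N(3) by linarith
    qed (use z in auto)
    also have "(\<zeta> * real l) * (2 * real l) = 2 * \<zeta> * (real l)\<^sup>2" by (simp add: power2_eq_square)
    finally have "card (induced E N) \<le> card (induced E W) + 2 * \<zeta> * (real l)\<^sup>2" by simp
    thus ?thesis using W N(1) by blast
  qed
  then obtain W where W: "W \<subseteq> {..<n}" "card W = l"
    "card (induced E N) \<le> card (induced E W) + 2 * \<zeta> * (real l)\<^sup>2" by blast
  have finW: "finite W" using W(1) finite_subset by blast
  have EW: "E \<inter> [W]\<^bsup>2\<^esup> = induced E W" using E(1) by (auto simp: induced_def nsets_def)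
  have finW2: "finite ([W]\<^bsup>2\<^esup>)" using finW by (simp add: finite_imp_finite_nsets)
  have cW2: "card ([W]\<^bsup>2\<^esup>) = l choose 2"
  proof -
    have "[W]\<^bsup>2\<^esup> = {B. B \<subseteq> W \<and> card B = 2}" using finW by (auto simp: nsets_def intro: finite_subset)
    thus ?thesis using n_subsets[OF finW] W(2) by simp
  qed
  have "card (E - [W]\<^bsup>2\<^esup>) + card (induced E W) = card E"
    using card_Int_Diff[OF finE, of "[W]\<^bsup>2\<^esup>"] EW by simp
  moreover have "card ([W]\<^bsup>2\<^esup> - E) + card (induced E W) = l choose 2"
    using card_Int_Diff[OF finW2, of E] EW cW2 by (simp add: Int_commute)
  ultimately have "card (E - [W]\<^bsup>2\<^esup>) + card ([W]\<^bsup>2\<^esup> - E) + 2 * card (induced E W) \<le> 2 * (l choose 2)"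
    using E(2) by linarith
  hence "card ((E - [W]\<^bsup>2\<^esup>) \<union> ([W]\<^bsup>2\<^esup> - E)) + 2 * card (induced E W) \<le> 2 * (l choose 2)"
    using card_Un_le[of "E - [W]\<^bsup>2\<^esup>" "[W]\<^bsup>2\<^esup> - E"] by linarith
  hence "real (card ((E - [W]\<^bsup>2\<^esup>) \<union> ([W]\<^bsup>2\<^esup> - E)) + 2 * card (induced E W)) \<le> real (2 * (l choose 2))"
    by (simp only: of_nat_le_iff)
  hence s: "real (card ((E - [W]\<^bsup>2\<^esup>) \<union> ([W]\<^bsup>2\<^esup> - E))) + 2 * real (card (induced E W)) \<le> 2 * real (l choose 2)"
    by simp
  have ch: "real (l choose 2) = (real l)\<^sup>2 / 2 - real l / 2"
    by (simp add: binomial_gbinomial gbinomial_prod_rev numeral_2_eq_2 power2_eq_square field_simps)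
  have l2: "2 * real l \<le> (real l)\<^sup>2" unfolding power2_eq_square using l(2) by (intro mult_right_mono) auto
  \<comment> \<open>For \<open>l \<ge> 2\<close> the binomial coefficient is at least a quarter of
    the square. With \<open>48 * \<zeta> \<le> \<epsilon>\<close> the allowed distance is then at
    least \<open>12 * \<zeta> * l\<^sup>2\<close>: 8 parts from the assumed density and 4 from
    passing to \<open>W\<close>.\<close>
  have "\<epsilon> * ((real l)\<^sup>2 / 4) \<le> \<epsilon> * real (l choose 2)"
    using ch l2 z by (intro mult_left_mono) auto
  moreover have "48 * \<zeta> * ((real l)\<^sup>2 / 4) \<le> \<epsilon> * ((real l)\<^sup>2 / 4)" using z by (intro mult_right_mono) auto
  ultimately have *: "48 * \<zeta> * ((real l)\<^sup>2 / 4) \<le> \<epsilon> * real (l choose 2)" by linarith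
  have "real (card ((E - [W]\<^bsup>2\<^esup>) \<union> ([W]\<^bsup>2\<^esup> - E))) \<le> \<epsilon> * real (l choose 2)"
  proof -
    have "(1 - 8 * \<zeta>) * (real l)\<^sup>2 = (real l)\<^sup>2 - 8 * (\<zeta> * (real l)\<^sup>2)" by (simp add: algebra_simps)
    moreover have "2 * \<zeta> * (real l)\<^sup>2 = 2 * (\<zeta> * (real l)\<^sup>2)"
      "48 * \<zeta> * ((real l)\<^sup>2 / 4) = 12 * (\<zeta> * (real l)\<^sup>2)" by simp_all
    ultimately show ?thesis using s W(3) big ch l(2) * by linarith
  qed
  thus False using far W(1,2) by (auto simp: close_to_complete_def)
qed

section \<open>The supersaturation theorem\<close>

lemma real_choose_2_le: "2 * real (l choose 2) \<le> (real l)\<^sup>2"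
proof -
  have "2 * (l choose 2) \<le> l * (l - 1)"
    unfolding choose_two by (rule times_div_less_eq_dividend)
  also have "\<dots> \<le> l * l" by simp
  finally have "2 * (l choose 2) \<le> l * l" .
  hence "real (2 * (l choose 2)) \<le> real (l * l)" by (simp only: of_nat_le_iff)
  thus ?thesis by (simp add: power2_eq_square)
qed

theorem theorem3p1:
  fixes \<epsilon> :: real
  assumes "\<epsilon> > 0"
  shows "\<exists>\<beta> \<delta> lam C :: real. \<beta> > 0 \<and> \<delta> > 0 \<and> lam > 0 \<and> C > 0 \<and>
    (\<forall>(l::nat) (n::nat) (M :: nat set set) (E :: nat set set).
      n \<ge> 1 \<longrightarrow>
      real l \<ge> C * sqrt (real n) \<longrightarrow>
      pregraph n M E \<longrightarrow>
      card E \<le> l choose 2 \<longrightarrow>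
      (real (card M) \<ge> 4 * real l * real n \<or>
       (real (card M) \<ge> (1 - \<delta>) * real l * real n \<and>
        \<not> close_to_complete n E \<epsilon> l \<and>
        real l \<le> lam * real n) \<or>
       (\<exists>U \<subseteq> {..<n}. card U = l \<and>
          real (card (induced E U)) \<ge> (1 - \<epsilon>) * real (l choose 2) \<and>
          real (card (induced M ({..<n} - U))) \<ge> 7 * sqrt \<epsilon> * real l * real n)) \<longrightarrow>
      (\<exists>i \<in> {0, 1, 2}. \<exists>H \<subseteq> C4_hypergraph M E i.
          real (card H) \<ge> \<beta> * real l ^ 4 \<and>
          real (max_hdeg M 0 1 H) \<le> real l ^ 3 / real n \<and>
          max_hdeg M 0 2 H \<le> l \<and>
          (i > 0 \<longrightarrow> max_hdeg M 1 0 H \<le> l ^ 2)))"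
proof -
  \<comment> \<open>\<open>\<epsilon>\<close> may exceed 1, so the constants are built from the
    capped value. \<open>\<zeta>\<close>, \<open>\<theta>\<close>, \<open>\<gamma>\<close> and
    \<open>lam\<close> then follow the hypotheses of the bound for (M2).\<close>
  define e where "e = min \<epsilon> 1"
  define \<zeta> where "\<zeta> = e / 48"
  define \<theta> where "\<theta> = \<zeta> / 40"
  define \<gamma> where "\<gamma> = \<theta>\<^sup>2 / 1000"
  \<comment> \<open>The factor 10000 covers the coefficients of \<open>card Q\<close> and
    \<open>card J\<close>, and \<open>e\<^sup>2\<close> allows the change of scale from
    \<open>l\<close> to \<open>t\<close> in (M3).\<close>
  define \<beta> where "\<beta> = \<gamma> * e\<^sup>2 / 10000"
  define lam where "lam = \<theta> ^ 4 / 576"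
  define C where "C = 100000 / (\<gamma> * e)"
  have e: "0 < e" "e \<le> 1" "e \<le> \<epsilon>" using assms by (auto simp: e_def)
  have e2: "0 < e\<^sup>2" "e\<^sup>2 \<le> e" "e\<^sup>2 \<le> 1" using e by (auto simp: power2_eq_square mult_le_one)
  have z: "0 < \<zeta>" "\<zeta> \<le> 1/48" "48 * \<zeta> \<le> \<epsilon>" using e by (auto simp: \<zeta>_def)
  have th: "0 < \<theta>" "\<theta> \<le> 1/1920" using z by (auto simp: \<theta>_def)
  have th2: "0 < \<theta>\<^sup>2" "\<theta>\<^sup>2 \<le> \<theta>" using th by (auto simp: power2_eq_square)
  have g: "0 < \<gamma>" "\<gamma> \<le> \<theta> / 1000" "\<gamma> \<le> 1/1000" using th th2 by (auto simp: \<gamma>_def)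
  have b: "0 < \<beta>" using g e2 by (simp add: \<beta>_def)
  have "\<gamma> * e\<^sup>2 \<le> \<gamma> * 1" using g e2 by (intro mult_left_mono) auto
  moreover have "\<gamma> * e\<^sup>2 \<le> 1 * e" using g e e2 by (intro mult_mono) auto
  ultimately have b2: "10000 * \<beta> \<le> \<gamma>" "10000 * \<beta> \<le> e" "10000 * \<beta> = \<gamma> * e\<^sup>2" by (auto simp: \<beta>_def)
  have lam: "0 < lam" "lam \<le> 1" using th power_le_one[of \<theta> 4] by (auto simp: lam_def)
  have ge: "0 < \<gamma> * e" "\<gamma> * e \<le> 1" using g e mult_mono[of \<gamma> 1 e 1] by auto
  have C: "C \<ge> 100000" using ge by (simp add: C_def le_divide_eq)
  have "(\<gamma> * e) * C = 100000" using g e by (simp add: C_def)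
  moreover have "(\<gamma> * e) * C\<^sup>2 = ((\<gamma> * e) * C) * C" by (simp add: power2_eq_square)
  ultimately have C2: "1 \<le> (\<gamma> * e) * C\<^sup>2" using C by simp
  have main: "\<exists>i \<in> {0, 1, 2}. \<exists>H \<subseteq> C4_hypergraph M E i.
          real (card H) \<ge> \<beta> * real l ^ 4 \<and>
          real (max_hdeg M 0 1 H) \<le> real l ^ 3 / real n \<and>
          max_hdeg M 0 2 H \<le> l \<and>
          (i > 0 \<longrightarrow> max_hdeg M 1 0 H \<le> l ^ 2)"
    if n: "n \<ge> 1" and l: "real l \<ge> C * sqrt (real n)" and pre: "pregraph n M E"
      and cE: "card E \<le> l choose 2"
      and cases: "real (card M) \<ge> 4 * real l * real n \<or>
       (real (card M) \<ge> (1 - \<zeta> / 4) * real l * real n \<and>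
        \<not> close_to_complete n E \<epsilon> l \<and>
        real l \<le> lam * real n) \<or>
       (\<exists>U \<subseteq> {..<n}. card U = l \<and>
          real (card (induced E U)) \<ge> (1 - \<epsilon>) * real (l choose 2) \<and>
          real (card (induced M ({..<n} - U))) \<ge> 7 * sqrt \<epsilon> * real l * real n)"
    for l n M E
  proof (rule ccontr)
    assume neg: "\<not> ?thesis"
    have ME: "M \<subseteq> [{..<n}]\<^bsup>2\<^esup>" "E \<subseteq> [{..<n}]\<^bsup>2\<^esup>" using pre by (auto simp: pregraph_def)
    have fin2: "finite ([{..<n}]\<^bsup>2\<^esup>)" by (simp add: finite_imp_finite_nsets)
    have finM: "finite M" and finE: "finite E" using ME fin2 by (auto intro: finite_subset)
    \<comment> \<open>Failure of the conclusion means that no balanced family reaches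
      \<open>\<beta> * l ^ 4\<close>, as the construction of saturated sets requires.\<close>
    have small: "real (card H) < \<beta> * real l ^ 4"
      if "i \<le> 2" "H \<subseteq> C4_hypergraph M E i" "balanced M n l i H" for i H
    proof (rule ccontr)
      assume big: "\<not> ?thesis"
      have "i \<in> {0, 1, 2}" using that(1) by auto
      thus False using neg that(2) balanced_max_hdeg[OF finM that(3)] big by (auto simp: not_less)
    qed
    have "C * 1 \<le> C * sqrt (real n)" using n C by (intro mult_left_mono) auto
    hence lC: "real l \<ge> C" using l by linarith
    hence l5: "real l \<ge> 100000" using C by linarith
    have "(C * sqrt (real n))\<^sup>2 \<le> (real l)\<^sup>2" using l C by (intro power_mono) auto
    hence Cn: "C\<^sup>2 * real n \<le> (real l)\<^sup>2" by (simp add: power_mult_distrib)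
    have "1 * real n \<le> (\<gamma> * e) * C\<^sup>2 * real n" using C2 by (intro mult_right_mono) auto
    also have "\<dots> \<le> (\<gamma> * e) * (real l)\<^sup>2" using mult_left_mono[OF Cn, of "\<gamma> * e"] ge by (simp add: mult.assoc)
    \<comment> \<open>The purpose of \<open>C\<close>: at scale \<open>t\<close> with
      \<open>t\<^sup>2 \<ge> e * l\<^sup>2\<close> this yields the locale's bound on the number of
      vertices.\<close>
    finally have nl: "real n \<le> (\<gamma> * e) * (real l)\<^sup>2" by simp
    have "(\<gamma> * e) * (real l)\<^sup>2 \<le> 1 * (real l)\<^sup>2" using ge by (intro mult_right_mono) auto
    hence nl1: "real n \<le> (real l)\<^sup>2" using nl by linarith
    have l3: "real l ^ 3 / real n \<ge> 2"
    proof -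
      have "2 * real n \<le> real l * (real l)\<^sup>2" using nl1 l5 by (intro mult_mono) auto
      thus ?thesis using n by (simp add: field_simps power2_eq_square power3_eq_cube)
    qed
    have "real l > real (2 ^ 16)" using l5 by simp
    hence l16: "l > 2 ^ 16" by (simp only: of_nat_less_iff)
    obtain M' E' Q J where M': "M' \<subseteq> M" "real (card (M - M')) \<le> 24 * \<beta> * real l * real n"
      and E': "E \<subseteq> E'" "E' \<subseteq> [{..<n}]\<^bsup>2\<^esup>" "real (card (E' - E)) \<le> 6 * \<beta> * (real l)\<^sup>2"
      and Q: "finite Q" "real (card Q) \<le> 3072 * \<beta> * real l ^ 3"
      and J: "finite J" "real (card J) \<le> 768 * \<beta> * real l ^ 4"
      and noC4: "\<And>x y x' y'. \<lbrakk>x \<noteq> x'; y \<noteq> y'; {x, y} \<in> M'; {y, x'} \<in> M'; {x', y'} \<in> M'; {y', x} \<in> M';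
        {x, x'} \<notin> E'; {y, y'} \<notin> E';
        (y, x, y') \<notin> Q; (y, x', y') \<notin> Q; (x, y, x') \<notin> Q; (x, y', x') \<notin> Q\<rbrakk>
        \<Longrightarrow> (x, y, x', y') \<in> J"
      by (rule few_C4_outside_saturated[OF pre n l16 l3]) 
        ((rule small; assumption), (rule that; assumption))
    have finM': "finite M'" and finE': "finite E'" using M'(1) finM E'(2) fin2 by (auto intro: finite_subset)
    have M'2: "M' \<subseteq> [{..<n}]\<^bsup>2\<^esup>" using M'(1) ME(1) by blast
    have forb: "real (card {(x, y) \<in> W \<times> W. {x, y} \<in> E'}) \<le>
        2 * real (card (induced E W)) + 12 * \<beta> * (real l)\<^sup>2" for W
    proof -
      have "card (induced E' W) \<le> card (induced E W \<union> (E' - E))"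
        using finE' finE by (intro card_mono) (auto simp: induced_def)
      also have "\<dots> \<le> card (induced E W) + card (E' - E)" by (rule card_Un_le)
      finally have "real (card (induced E' W)) \<le> real (card (induced E W)) + real (card (E' - E))"
        by (simp flip: of_nat_add)
      thus ?thesis using E'(3) card_ordered_pairs[OF E'(2) finE', of W] by simp
    qed
    have adj: "real (card {(x, y) \<in> W \<times> W. {x, y} \<in> M'}) \<ge>
        2 * real (card (induced M W)) - 48 * \<beta> * real l * real n" for W
    proof -
      have "card (induced M W) \<le> card (induced M' W \<union> (M - M'))"
        using finM' finM by (intro card_mono) (auto simp: induced_def)
      also have "\<dots> \<le> card (induced M' W) + card (M - M')" by (rule card_Un_le)
      finally have "real (card (induced M W)) \<le> real (card (induced M' W)) + real (card (M - M'))"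
        by (simp flip: of_nat_add)
      thus ?thesis using M'(2) card_ordered_pairs[OF M'2 finM', of W] by simp
    qed
    have upper: "2 * real (card (induced M W)) \<le> real n * real n" if "W \<subseteq> {..<n}" for W
    proof -
      have "2 * card (induced M W) = card {(x, y) \<in> W \<times> W. {x, y} \<in> M}"
        using card_ordered_pairs[OF ME(1) finM] by simp
      also have "\<dots> \<le> card ({..<n} \<times> {..<n})" by (rule card_mono) (use that in auto)
      also have "\<dots> = n * n" by (simp add: card_cartesian_product)
      finally have "real (2 * card (induced M W)) \<le> real (n * n)" by (simp only: of_nat_le_iff)
      thus ?thesis by simp
    qed
    \<comment> \<open>Used at two scales: \<open>t = l\<close> on all vertices for (M1) and (M2),
      and \<open>t = sqrt \<epsilon> * l\<close> on the complement of \<open>U\<close> for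
      (M3).\<close>
    have inst: "almost_C4_free W (\<lambda>x y. {x, y} \<in> M') (\<lambda>x y. {x, y} \<in> E') Q J t \<gamma>"
      if W: "W \<subseteq> {..<n}" and t: "t > 0" "e * (real l)\<^sup>2 \<le> t\<^sup>2" "e\<^sup>2 * real l ^ 3 \<le> t ^ 3" "e\<^sup>2 * real l ^ 4 \<le> t ^ 4"
        and f: "real (card {(x, y) \<in> W \<times> W. {x, y} \<in> E'}) \<le> 3/2 * t\<^sup>2" for W t
    proof
      show "finite W" using W finite_subset by blast
      show "finite Q" "finite J" "t > 0" by (fact Q J t)+
      show "{y, x} \<in> M'" if "{x, y} \<in> M'" for x y using that by (simp add: insert_commute)
      show "{y, x} \<in> E'" if "{x, y} \<in> E'" for x y using that by (simp add: insert_commute)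
      have "card W \<le> card {..<n}" by (rule card_mono[OF _ W]) simp
      hence "real (card W) \<le> \<gamma> * (e * (real l)\<^sup>2)" using nl by (simp add: mult.assoc)
      also have "\<dots> \<le> \<gamma> * t\<^sup>2" using g t by (intro mult_left_mono) auto
      finally show "real (card W) \<le> \<gamma> * t\<^sup>2" .
      have "real (card Q) \<le> (10000 * \<beta>) * real l ^ 3"
        using Q(2) mult_right_mono[of "3072 * \<beta>" "10000 * \<beta>" "real l ^ 3"] b by simp
      also have "\<dots> = \<gamma> * (e\<^sup>2 * real l ^ 3)" using b2(3) by simp
      also have "\<dots> \<le> \<gamma> * t ^ 3" using g t by (intro mult_left_mono) auto
      finally show "real (card Q) \<le> \<gamma> * t ^ 3" .
      have "real (card J) \<le> (10000 * \<beta>) * real l ^ 4"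
        using J(2) mult_right_mono[of "768 * \<beta>" "10000 * \<beta>" "real l ^ 4"] b by simp
      also have "\<dots> = \<gamma> * (e\<^sup>2 * real l ^ 4)" using b2(3) by simp
      also have "\<dots> \<le> \<gamma> * t ^ 4" using g t by (intro mult_left_mono) auto
      finally show "real (card J) \<le> \<gamma> * t ^ 4" .
      show "real (card {(x, y) \<in> W \<times> W. {x, y} \<in> E'}) \<le> 3/2 * t\<^sup>2" by (rule f)
    qed (rule noC4)
    have ln0: "0 < real l * real n" using l5 n by simp
    have bl: "48 * \<beta> * real l * real n \<le> \<gamma> * (real l * real n)"
      using mult_right_mono[of "48 * \<beta>" \<gamma> "real l * real n"] b2 b ln0 by (simp add: mult.assoc)
    have EV: "induced E {..<n} = E" "induced M {..<n} = M" using ME by (auto simp: induced_def nsets_def)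
    have forbV: "real (card {(x, y) \<in> {..<n} \<times> {..<n}. {x, y} \<in> E'}) \<le> (1 + \<gamma>) * (real l)\<^sup>2"
    proof -
      have "2 * real (card E) \<le> 2 * real (l choose 2)" using cE by simp
      moreover have "12 * \<beta> * (real l)\<^sup>2 \<le> \<gamma> * (real l)\<^sup>2" using b2 b by (intro mult_right_mono) auto
      ultimately show ?thesis using forb[of "{..<n}"] real_choose_2_le[of l]
        unfolding EV distrib_right by linarith
    qed
    have instV: "almost_C4_free {..<n} (\<lambda>x y. {x, y} \<in> M') (\<lambda>x y. {x, y} \<in> E') Q J (real l) \<gamma>"
    proof (rule inst)
      show "real l > 0" using l5 by simp
      show "e * (real l)\<^sup>2 \<le> (real l)\<^sup>2" using e mult_right_mono[of e 1 "(real l)\<^sup>2"] by simp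
      show "e\<^sup>2 * real l ^ 3 \<le> real l ^ 3" using e2 mult_right_mono[of "e\<^sup>2" 1 "real l ^ 3"] by simp
      show "e\<^sup>2 * real l ^ 4 \<le> real l ^ 4" using e2 mult_right_mono[of "e\<^sup>2" 1 "real l ^ 4"] by simp
      have "(1 + \<gamma>) * (real l)\<^sup>2 \<le> 3/2 * (real l)\<^sup>2" using g by (intro mult_right_mono) auto
      thus "real (card {(x, y) \<in> {..<n} \<times> {..<n}. {x, y} \<in> E'}) \<le> 3/2 * (real l)\<^sup>2"
        using forbV by linarith
    qed simp
    consider (M1) "real (card M) \<ge> 4 * real l * real n"
      | (M2) "real (card M) \<ge> (1 - \<zeta> / 4) * real l * real n" "\<not> close_to_complete n E \<epsilon> l"
          "real l \<le> lam * real n"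
      | (M3) U where "U \<subseteq> {..<n}" "real (card (induced E U)) \<ge> (1 - \<epsilon>) * real (l choose 2)"
          "real (card (induced M ({..<n} - U))) \<ge> 7 * sqrt \<epsilon> * real l * real n"
      using cases by blast
    thus False
    proof cases
      case M1
      interpret almost_C4_free "{..<n}" "\<lambda>x y. {x, y} \<in> M'" "\<lambda>x y. {x, y} \<in> E'" Q J "real l" \<gamma>
        by (rule instV)
      \<comment> \<open>The trivial bound on \<open>card M\<close> gives \<open>l \<le> n\<close>,
        so the error \<open>4 * \<gamma> * l\<^sup>2\<close> is at most \<open>l * n\<close>. The
        degree sum is then at most six times \<open>l * n\<close>, against almost eight times from
        (M1).\<close>
      have "8 * real l * real n \<le> real n * real n" using upper[of "{..<n}"] M1 EV by simp
      hence "real l \<le> real n" using n by simp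
      hence "4 * \<gamma> * (real l)\<^sup>2 \<le> 1 * (real l * real n)"
        unfolding power2_eq_square using g by (intro mult_mono) auto
      moreover have "real (card {(x, y) \<in> {..<n} \<times> {..<n}. {x, y} \<in> M'}) \<le> 5 * real l * real (card {..<n}) + 4 * \<gamma> * (real l)\<^sup>2"
        using sum_degrees_le[OF order_refl] l5 g unfolding sum_card_nb[OF order_refl] by simp
      moreover have "\<gamma> * (real l * real n) \<le> 1 * (real l * real n)" using g ln0 by (intro mult_right_mono) auto
      ultimately show False using adj[of "{..<n}"] M1 bl ln0 unfolding EV by simp
    next
      case M2
      interpret almost_C4_free "{..<n}" "\<lambda>x y. {x, y} \<in> M'" "\<lambda>x y. {x, y} \<in> E'" Q J "real l" \<gamma>
        by (rule instV)
      have "lam * real n \<le> 1 * real n" using lam by (intro mult_right_mono) auto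
      hence ln: "l \<le> n" using M2(3) by simp
      have "real (card {(x, y) \<in> {..<n} \<times> {..<n}. {x, y} \<in> M'}) \<le> (2 - \<zeta>) * real l * real (card {..<n})"
        unfolding sum_card_nb[OF order_refl, symmetric]
      proof (rule sum_degrees_le_of_far)
        show "real (card {(x, y) \<in> N \<times> N. {x, y} \<in> E'}) \<le> (1 - 7 * \<zeta>) * (real l)\<^sup>2"
          if N: "N \<subseteq> {..<n}" "(1 - \<zeta>) * real l \<le> real (card N)" "real (card N) \<le> (1 + \<zeta>) * real l" for N
        proof -
          have "2 * real (card (induced E N)) \<le> (1 - 8 * \<zeta>) * (real l)\<^sup>2"
            by (rule card_induced_le_of_not_close[OF ME(2) cE M2(2) ln _ z(1) _ z(3) N])
              (use l5 z in auto)
          moreover have "12 * \<beta> \<le> \<zeta>" using b b2(1) g(2) z(1) unfolding \<theta>_def by linarith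
          hence "12 * \<beta> * (real l)\<^sup>2 \<le> \<zeta> * (real l)\<^sup>2" by (intro mult_right_mono) auto
          ultimately show ?thesis using forb[of N] by (simp add: left_diff_distrib)
        qed
        show "real l \<le> \<theta> ^ 4 / 576 * real (card {..<n})" using M2(3) by (simp add: lam_def)
      qed (use z g forbV in \<open>auto simp: \<theta>_def \<gamma>_def\<close>)
      moreover have "2 * ((1 - \<zeta> / 4) * real l * real n) - \<gamma> * (real l * real n) \<le>
          real (card {(x, y) \<in> {..<n} \<times> {..<n}. {x, y} \<in> M'})"
        using adj[of "{..<n}"] M2(1) bl unfolding EV by linarith
      ultimately have "(2 - \<zeta> / 2 - \<gamma>) * (real l * real n) \<le> (2 - \<zeta>) * (real l * real n)"
        by (simp add: algebra_simps)
      \<comment> \<open>With \<open>\<zeta> / 4\<close> in the role of \<delta>, the lower bound on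
        the degree sum loses only \<open>\<zeta> / 2 + \<gamma>\<close>, which is less than
        \<open>\<zeta>\<close>.\<close>
      hence "2 - \<zeta> / 2 - \<gamma> \<le> 2 - \<zeta>" using ln0 by (simp only: mult_le_cancel_right_pos)
      thus False using g z by (simp add: \<theta>_def)
    next
      case M3
      define t where "t = sqrt \<epsilon> * real l"
      define W where "W = {..<n} - U"
      have se: "0 < sqrt \<epsilon>" using assms by simp
      have t0: "t > 0" using se l5 by (simp add: t_def)
      have t2: "t\<^sup>2 = \<epsilon> * (real l)\<^sup>2" using assms by (simp add: t_def power_mult_distrib)
      have se1: "sqrt e \<le> sqrt \<epsilon>" using e by simp
      have se2: "e \<le> sqrt e"
        using e e2 by (intro real_le_rsqrt) auto
      have se3: "e \<le> sqrt \<epsilon>" using se1 se2 by linarith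
      have W: "W \<subseteq> {..<n}" by (auto simp: W_def)
      have inst3: "almost_C4_free W (\<lambda>x y. {x, y} \<in> M') (\<lambda>x y. {x, y} \<in> E') Q J t \<gamma>"
      proof (rule inst[OF W t0])
        show "e * (real l)\<^sup>2 \<le> t\<^sup>2" unfolding t2 using e by (intro mult_right_mono) auto
        have "e * e \<le> \<epsilon> * sqrt \<epsilon>" using e se3 by (intro mult_mono) auto
        also have "\<dots> = sqrt \<epsilon> ^ 3" using assms by (simp add: power3_eq_cube)
        finally show "e\<^sup>2 * real l ^ 3 \<le> t ^ 3"
          unfolding t_def power_mult_distrib by (intro mult_right_mono) (auto simp: power2_eq_square)
        have "e * e \<le> \<epsilon> * \<epsilon>" using e by (intro mult_mono) auto
        also have "\<dots> = sqrt \<epsilon> ^ 4" using assms by (simp add: power4_eq_xxxx mult.assoc)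
        finally show "e\<^sup>2 * real l ^ 4 \<le> t ^ 4"
          unfolding t_def power_mult_distrib by (intro mult_right_mono) (auto simp: power2_eq_square)
        \<comment> \<open>\<open>U\<close> already holds all but a fraction
          \<open>\<epsilon>\<close> of the permitted \<open>l choose 2\<close> edges, so few are
          left on the complement. This is why \<open>sqrt \<epsilon> * l\<close> is the right scale
          there.\<close>
        have "card (induced E U) + card (induced E W) \<le> card E"
        proof -
          have "induced E U \<inter> induced E W = {}"
          proof (rule equals0I)
            fix p assume "p \<in> induced E U \<inter> induced E W"
            hence "p \<in> E" "p \<subseteq> U" "p \<subseteq> W" by (simp_all add: induced_def)
            hence "p = {}" "card p = 2" using ME(2) by (auto simp: W_def nsets_def)
            thus False by simp
          qed
          hence "card (induced E U) + card (induced E W) = card (induced E U \<union> induced E W)"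
            using finE by (intro card_Un_disjoint[symmetric]) (auto simp: induced_def)
          also have "\<dots> \<le> card E" using finE by (intro card_mono) (auto simp: induced_def)
          finally show ?thesis .
        qed
        hence "real (card (induced E U)) + real (card (induced E W)) \<le> real (l choose 2)"
          using cE by linarith
        hence "real (card (induced E W)) \<le> \<epsilon> * real (l choose 2)"
          using M3(2) by (simp add: algebra_simps)
        moreover have "\<epsilon> * (2 * real (l choose 2)) \<le> \<epsilon> * (real l)\<^sup>2"
          using assms by (intro mult_left_mono real_choose_2_le) auto
        ultimately have "2 * real (card (induced E W)) \<le> \<epsilon> * (real l)\<^sup>2" by linarith
        moreover have "12 * \<beta> \<le> \<epsilon> / 2" using b b2(2) e by linarith
        hence "12 * \<beta> * (real l)\<^sup>2 \<le> \<epsilon> / 2 * (real l)\<^sup>2" by (intro mult_right_mono) auto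
        ultimately show "real (card {(x, y) \<in> W \<times> W. {x, y} \<in> E'}) \<le> 3/2 * t\<^sup>2"
          using forb[of W] unfolding t2 by simp
      qed
      interpret almost_C4_free W "\<lambda>x y. {x, y} \<in> M'" "\<lambda>x y. {x, y} \<in> E'" Q J t \<gamma>
        by (rule inst3)
      have tn: "7 * (t * real n) \<le> real (card (induced M W))" using M3(3) by (simp add: t_def W_def)
      hence "14 * t * real n \<le> real n * real n" using upper[OF W] by simp
      hence tn1: "14 * t \<le> real n" using n by simp
      have tn0: "0 < t * real n" using t0 n by simp
      have cW: "real (card W) \<le> real n" using card_mono[OF _ W] by simp
      have t4: "t \<ge> 4"
      proof -
        have "1 \<le> \<gamma> * t\<^sup>2"
        proof -
          have "real n \<le> \<gamma> * (e * (real l)\<^sup>2)" using nl by (simp add: mult.assoc)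
          also have "\<dots> \<le> \<gamma> * t\<^sup>2" unfolding t2 using g e by (intro mult_left_mono mult_right_mono) auto
          finally show ?thesis using n by linarith
        qed
        also have "\<dots> \<le> 1/1000 * t\<^sup>2" using g by (intro mult_right_mono) auto
        finally have "4\<^sup>2 \<le> t\<^sup>2" by simp
        thus ?thesis by (rule power2_le_imp_le) (use t0 in simp)
      qed
      have "4 * \<gamma> * t\<^sup>2 \<le> 1 * (t * real n)"
        unfolding power2_eq_square using g tn1 t0 by (intro mult_mono) auto
      moreover have "real (card {(x, y) \<in> W \<times> W. {x, y} \<in> M'}) \<le> 5 * t * real (card W) + 4 * \<gamma> * t\<^sup>2"
        using sum_degrees_le[OF order_refl t4] g unfolding sum_card_nb[OF order_refl] by simp
      moreover have "5 * t * real (card W) \<le> 5 * (t * real n)" using cW t0 by simp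
      moreover have "48 * \<beta> * real l * real n \<le> t * real n"
      proof -
        have "48 * \<beta> \<le> sqrt \<epsilon>" using b2 b se1 se2 by linarith
        hence "48 * \<beta> * (real l * real n) \<le> sqrt \<epsilon> * (real l * real n)"
          using ln0 by (intro mult_right_mono) auto
        thus ?thesis by (simp add: t_def mult.assoc)
      qed
      \<comment> \<open>The mixed edges outside \<open>U\<close> give a degree sum of at least 14 -
        1 times \<open>t * n\<close>, whereas the upper bound is 5 + 1 times
        \<open>t * n\<close>.\<close>
      ultimately show False using adj[of W] tn tn0 by linarith
    qed
  qed
  show ?thesis
  proof (rule exI[of _ \<beta>], rule exI[of _ "\<zeta> / 4"], rule exI[of _ lam], rule exI[of _ C], intro conjI allI impI)
    show "\<beta> > 0" "\<zeta> / 4 > 0" "lam > 0" "C > 0" using b z lam C by auto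
  qed (rule main)
qed

end
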